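(* Let $a$ be a nonzero rational number. (1) The polynomial $x^5+ax^2+x+a$ has no quadratic factor $x^2+px+q$ with $p,q\in\mathbb{Q}$. (2) The polynomial $x^5+ax^4+x+a$ has no quadratic factor $x^2+px+q$ with $p,q\in\mathbb{Q}$.
   Context: All polynomials are in $\mathbb{Q}[x]$; a quadratic factor means a monic quadratic with rational coefficients dividing the polynomial in $\mathbb{Q}[x]$. *)

theory Defs
  imports Complex_Main "HOL-Computational_Algebra.Polynomial"
begin

definition has_quadratic_factor :: "rat poly \<Rightarrow> bool" where
  "has_quadratic_factor f \<longleftrightarrow> (\<exists>p q :: rat. [:q, p, 1:] dvd f)"

end

theory Submission
  imports Defs "HOL-Analysis.Analysis" "HOL-Computational_Algebra.Nth_Powers"
begin

text \<open>
  The second polynomial is $(x+a)(x^4+1)$, so only the first one needs work. If $x^2+px+q$ divides it,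
  put $t=q-1$; eliminating $a$ from the vanishing remainder shows that $u=(t^2+p^2-2)/t$ is the abscissa
  of a rational point on the curve $v^2=(u-2)(u^3+5u-2)$, an elliptic curve of conductor 38 whose
  group of rational points is cyclic of order 5, namely the points with $u\in\{0,2,\infty\}$.

  This is proved by a 2-descent in $\mathbb{Z}[\theta]$, $\theta^3+5\theta=2$. For $u=m/n$ one has
  $m-2n=c\delta^2$ and $N(m-\theta n)=cs^2$ with $c\in\{1,2\}$ up to a common sign. Instead of class group
  and units, Minkowski's theorem is applied to the ideal $(m-\theta n,s)$ with a box adapted to
  the conjugates of $m-\theta n$: it gives $\beta$ with $c\beta^2=(m-\theta n)\gamma$ and all conjugates of
  $\gamma$ bounded, so $\gamma$ lies in a short explicit list. All square classes on the list but the
  trivial one are excluded by congruences modulo 16 (or modulo 5 and 11, where a prime of degree two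
  would have to divide $m-\theta n$). Hence $c(m-\theta n)$ is a square in the field, the point is twice
  another point of smaller height, and infinite descent applies.
\<close>

section \<open>Minkowski's theorem on linear forms\<close>

text \<open>Cut \<open>S\<close> along unit cells and translate each piece into the unit cube. If no
  two distinct points differed by an integral vector, the translates would be disjoint and the
  volume at most 1.\<close>

lemma blichfeldt:
  fixes S :: "(real^'n) set"
  assumes S: "S \<in> lmeasurable" "bounded S" and gt: "measure lebesgue S > 1"
  shows "\<exists>x\<in>S. \<exists>y\<in>S. x \<noteq> y \<and> (\<forall>i. (x - y) $ i \<in> \<int>)"
proof (rule ccontr)
  assume neg: "\<not> ?thesis"
  define fl :: "real^'n \<Rightarrow> real^'n" where "fl x = (\<chi> i. of_int \<lfloor>x $ i\<rfloor>)" for x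
  \<comment> \<open>The half-open cell is a closed set intersected with an open one, which makes
    measurability immediate.\<close>
  define cell where "cell k = {x. \<forall>i. k $ i \<le> x $ i} \<inter> {x. \<forall>i. x $ i < k $ i + 1}" for k :: "real^'n"
  define I where "I = fl ` S"
  define P where "P k = S \<inter> cell k" for k
  define Q where "Q k = (\<lambda>x. x - k) ` P k" for k
  obtain B where B: "\<And>x. x \<in> S \<Longrightarrow> norm x \<le> B"
    using S(2) by (auto simp: bounded_iff)
  let ?J = "of_int ` {-\<lceil>B\<rceil> - 1..\<lceil>B\<rceil> + 1} :: real set"
  have fin: "finite I"
  proof (rule finite_subset)
    show "I \<subseteq> vec_lambda ` (PiE UNIV (\<lambda>_. ?J))"
    proof (clarsimp simp: I_def fl_def)
      fix x assume "x \<in> S"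
      then have "\<bar>x $ i\<bar> \<le> B" for i
        using B component_le_norm_cart order_trans by blast
      then have "real_of_int \<lfloor>x $ i\<rfloor> \<in> ?J" for i
        by (intro imageI) (simp add: abs_le_iff, smt (verit) ceiling_mono floor_le_ceiling
            floor_mono le_floor_iff minus_le_iff ceiling_minus floor_less_iff le_of_int_ceiling of_int_minus)
      then show "(\<chi> i. real_of_int \<lfloor>x $ i\<rfloor>) \<in> vec_lambda ` (PiE UNIV (\<lambda>_. ?J))"
        by (intro imageI) (auto simp: PiE_def)
    qed
    show "finite (vec_lambda ` (PiE UNIV (\<lambda>_. ?J)) :: (real^'n) set)"
      by (intro finite_imageI finite_PiE) auto
  qed
  have "cell k \<in> sets lebesgue" for k
  proof -
    have "closed {x :: real^'n. \<forall>i. k $ i \<le> x $ i}"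
      by (intro closed_Collect_all closed_Collect_le continuous_intros)
    moreover have "open {x :: real^'n. \<forall>i. x $ i < k $ i + 1}"
      unfolding Collect_all_eq by (intro open_INT ballI open_Collect_less continuous_intros) auto
    ultimately show ?thesis
      unfolding cell_def by (intro sets.Int) auto
  qed
  then have Pm: "P k \<in> lmeasurable" for k
    unfolding P_def by (rule fmeasurable_Int_fmeasurable[OF S(1)])
  then have Qm: "Q k \<in> lmeasurable" for k
    unfolding Q_def by (rule measurable_translation_subtract)
  have fl_cell: "x \<in> cell (fl x)" for x
    by (simp add: cell_def fl_def)
  have "S = (\<Union>k\<in>I. P k)"
    using fl_cell by (auto simp: P_def I_def)
  then have "measure lebesgue S \<le> (\<Sum>k\<in>I. measure lebesgue (P k))"
    using measure_UNION_le[OF fin, of P lebesgue] Pm by (auto simp: fmeasurableD)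
  also have "\<dots> = (\<Sum>k\<in>I. measure lebesgue (Q k))"
    by (simp add: Q_def measure_translation_subtract)
  also have "\<dots> = measure lebesgue (\<Union>k\<in>I. Q k)"
  proof (rule measure_UNION'[symmetric, OF fin Qm])
    show "pairwise (\<lambda>i j. disjnt (Q i) (Q j)) I"
    proof (clarsimp simp: pairwise_def disjnt_iff)
      fix k l z assume kl: "k \<in> I" "l \<in> I" "k \<noteq> l" "z \<in> Q k" "z \<in> Q l"
      obtain x y where xy: "x \<in> S" "y \<in> S" "z = x - k" "z = y - l"
        using kl by (auto simp: Q_def P_def)
      then have d: "x - y = k - l" by (simp add: algebra_simps)
      moreover have "(k - l) $ i \<in> \<int>" for i
        using kl(1,2) by (auto simp: I_def fl_def)
      ultimately show False
        using neg xy(1,2) kl(3) by (metis right_minus_eq)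
    qed
  qed
  also have "\<dots> \<le> measure lebesgue (cbox 0 1 :: (real^'n) set)"
  proof (rule measure_mono_fmeasurable)
    show "(\<Union>k\<in>I. Q k) \<subseteq> cbox 0 1"
    proof clarsimp
      fix k z assume "z \<in> Q k"
      then obtain x where "x \<in> cell k" "z = x - k" by (auto simp: Q_def P_def)
      then show "z \<in> cbox 0 1"
        by (auto simp: cell_def mem_box_cart algebra_simps intro: less_imp_le)
    qed
  qed (use fin Qm in \<open>auto intro!: fmeasurableD sets.finite_UN\<close>)
  also have "\<dots> = 1"
  proof -
    have "(0 :: real^'n) \<in> cbox 0 1" by (simp add: mem_box_cart)
    then have "cbox 0 (1 :: real^'n) \<noteq> {}" by blast
    then show ?thesis by (simp add: content_cbox_cart)
  qed
  finally show False using gt by simp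
qed

text \<open>Blichfeldt for the preimage under \<open>A\<close> of a centred box with half-sides
  \<open>T $ i / 2\<close>. Differences of its points are bounded by \<open>T $ i\<close>, so no
  power of 2 enters the volume condition.\<close>

lemma minkowski_linear_forms:
  fixes A :: "real^'n::{finite,wellorder}^'n::_" and T :: "real^'n::_"
  assumes det: "det A \<noteq> 0" "\<bar>det A\<bar> < (\<Prod>i\<in>UNIV. T $ i)" and T: "\<And>i. T $ i > 0"
  shows "\<exists>v. v \<noteq> 0 \<and> (\<forall>i. v $ i \<in> \<int>) \<and> (\<forall>i. \<bar>(A *v v) $ i\<bar> \<le> T $ i)"
proof -
  obtain B where AB: "A ** B = mat 1" and BA: "B ** A = mat 1"
    using det(1) by (metis invertible_def invertible_det_nz)
  define C where "C = cbox (- T /\<^sub>R 2) (T /\<^sub>R 2)"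
  define S where "S = (*v) B ` C"
  have "det A * det B = 1"
    using AB by (metis det_I det_mul)
  then have dB: "\<bar>det B\<bar> = 1 / \<bar>det A\<bar>"
    by (metis abs_mult abs_one det(1) eq_divide_eq mult.commute abs_eq_0)
  have Clm: "C \<in> lmeasurable" by (simp add: C_def)
  have "0 \<in> C"
    using T by (simp add: C_def mem_box_cart less_imp_le)
  then have "C \<noteq> {}" by blast
  then have "measure lebesgue C = (\<Prod>i\<in>UNIV. T $ i)"
    by (simp add: C_def content_cbox_cart)
  moreover have "measure lebesgue S = \<bar>det B\<bar> * measure lebesgue C"
    unfolding S_def using measure_linear_image[OF matrix_vector_mul_linear Clm, of B]
    by simp
  ultimately have "measure lebesgue S = (\<Prod>i\<in>UNIV. T $ i) / \<bar>det A\<bar>"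
    by (simp add: dB)
  then have "measure lebesgue S > 1"
    using det by (simp add: less_divide_eq)
  moreover have "S \<in> lmeasurable"
    unfolding S_def by (intro measurable_linear_image Clm) simp
  moreover have "bounded S"
    unfolding S_def C_def
    by (intro bounded_linear_image bounded_cbox) (simp add: linear_conv_bounded_linear[symmetric])
  ultimately obtain x y where xy: "x \<in> S" "y \<in> S" "x \<noteq> y" "\<forall>i. (x - y) $ i \<in> \<int>"
    using blichfeldt by blast
  then obtain a b where ab: "a \<in> C" "b \<in> C" "x = B *v a" "y = B *v b"
    by (auto simp: S_def)
  have "A *v (x - y) = a - b"
    using AB by (simp add: ab matrix_vector_mult_diff_distrib matrix_vector_mul_assoc)
  moreover have "\<bar>(a - b) $ i\<bar> \<le> T $ i" for i
  proof -
    have "- (T $ i / 2) \<le> a $ i" "a $ i \<le> T $ i / 2" "- (T $ i / 2) \<le> b $ i" "b $ i \<le> T $ i / 2"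
      using ab(1,2) by (auto simp: C_def mem_box_cart)
    then show ?thesis by simp
  qed
  ultimately show ?thesis
    using xy(3,4) by (metis right_minus_eq)
qed

section \<open>The cubic ring\<close>

text \<open>\<open>Cub x y z\<close> stands for $x+y\theta+z\theta^2$ with $\theta^3+5\theta=2$.\<close>

datatype cub = Cub (cf0: int) (cf1: int) (cf2: int)

instantiation cub :: comm_ring_1
begin

definition zero_cub where "0 = Cub 0 0 0"
definition one_cub where "1 = Cub 1 0 0"
definition plus_cub where
  "a + b = Cub (cf0 a + cf0 b) (cf1 a + cf1 b) (cf2 a + cf2 b)"
definition minus_cub where
  "a - b = Cub (cf0 a - cf0 b) (cf1 a - cf1 b) (cf2 a - cf2 b)"
definition uminus_cub where
  "- a = Cub (- cf0 a) (- cf1 a) (- cf2 a)"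
text \<open>Products are reduced by \<open>\<theta>^3 = 2 - 5 \<theta>\<close> and
  \<open>\<theta>^4 = 2 \<theta> - 5 \<theta>^2\<close>.\<close>

definition times_cub where
  "a * b = Cub (cf0 a * cf0 b + 2 * (cf1 a * cf2 b + cf2 a * cf1 b))
     (cf0 a * cf1 b + cf1 a * cf0 b - 5 * (cf1 a * cf2 b + cf2 a * cf1 b) + 2 * (cf2 a * cf2 b))
     (cf0 a * cf2 b + cf1 a * cf1 b + cf2 a * cf0 b - 5 * (cf2 a * cf2 b))"

instance
  by standard (auto simp: zero_cub_def one_cub_def plus_cub_def minus_cub_def uminus_cub_def
      times_cub_def algebra_simps)

end

lemma cub_simps [simp]:
  "cf0 (a + b) = cf0 a + cf0 b" "cf1 (a + b) = cf1 a + cf1 b" "cf2 (a + b) = cf2 a + cf2 b"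
  "cf0 (a - b) = cf0 a - cf0 b" "cf1 (a - b) = cf1 a - cf1 b" "cf2 (a - b) = cf2 a - cf2 b"
  "cf0 (- a) = - cf0 a" "cf1 (- a) = - cf1 a" "cf2 (- a) = - cf2 a"
  "cf0 0 = 0" "cf1 0 = 0" "cf2 0 = 0" "cf0 1 = 1" "cf1 1 = 0" "cf2 1 = 0"
  by (simp_all add: zero_cub_def one_cub_def plus_cub_def minus_cub_def uminus_cub_def)

lemma cub_mult:
  "Cub a b c * Cub x y z = Cub (a * x + 2 * (b * z + c * y))
     (a * y + b * x - 5 * (b * z + c * y) + 2 * (c * z)) (a * z + b * y + c * x - 5 * (c * z))"
  by (simp add: times_cub_def)

lemma of_nat_cub: "of_nat k = Cub (int k) 0 0"
  by (induction k) (auto intro: cub.expand simp: zero_cub_def plus_cub_def)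

lemma of_int_cub: "of_int k = Cub k 0 0"
  by (cases k) (auto simp: of_nat_cub uminus_cub_def minus_cub_def)

text \<open>The field norm. On \<open>Cub m (- n) 0\<close> it is
  \<open>m^3 + 5 m n^2 - 2 n^3\<close>, the homogenised cubic factor of the curve.\<close>

definition cnorm :: "cub \<Rightarrow> int" where
  "cnorm a = (case a of Cub x y z \<Rightarrow> x^3 + 2*y^3 + 4*z^3 - 10*x^2*z + 5*x*y^2 + 25*x*z^2 - 6*x*y*z + 10*y*z^2)"

text \<open>The product of the other two conjugates, which serves as an inverse up to the
  norm.\<close>

definition cadj :: "cub \<Rightarrow> cub" where
  "cadj a = (case a of Cub x y z \<Rightarrow> Cub ((x - 5*z)^2 - y*(2*z - 5*y)) (z*(2*z - 5*y) - y*(x - 5*z)) (y^2 - z*(x - 5*z)))"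

lemma mult_cadj: "a * cadj a = of_int (cnorm a)"
  by (cases a) (simp add: cadj_def cnorm_def cub_mult of_int_cub algebra_simps power2_eq_square power3_eq_cube)

lemma cnorm_mult: "cnorm (a * b) = cnorm a * cnorm b"
proof (cases a)
  case a: (Cub x y z)
  show ?thesis
  proof (cases b)
    case b: (Cub u v w)
    show ?thesis
      unfolding a b cub_mult cnorm_def cub.case by algebra
  qed
qed

lemma cnorm_of_int [simp]: "cnorm (of_int k) = k ^ 3"
  by (simp add: of_int_cub cnorm_def)

lemma cnorm_Cub_mod: "cnorm (Cub x y z) mod k = cnorm (Cub (x mod k) (y mod k) (z mod k)) mod k"
  unfolding cnorm_def cub.case power2_eq_square power3_eq_cube
  by (intro mod_add_cong mod_diff_cong mod_mult_cong refl) simp_all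

text \<open>The cubic is irreducible modulo 3, which makes the norm form anisotropic.\<close>

lemma three_dvd_cnorm:
  assumes "3 dvd cnorm (Cub x y z)"
  shows "3 dvd x" "3 dvd y" "3 dvd z"
proof -
  have *: "x mod 3 = 0 \<or> x mod 3 = 1 \<or> x mod 3 = 2" "y mod 3 = 0 \<or> y mod 3 = 1 \<or> y mod 3 = 2"
    "z mod 3 = 0 \<or> z mod 3 = 1 \<or> z mod 3 = 2" by presburger+
  have "cnorm (Cub (x mod 3) (y mod 3) (z mod 3)) mod 3 = 0"
    using assms cnorm_Cub_mod[of x y z 3] by auto
  then have "x mod 3 = 0 \<and> y mod 3 = 0 \<and> z mod 3 = 0"
    using * by (elim disjE) (simp_all add: cnorm_def)
  then show "3 dvd x" "3 dvd y" "3 dvd z" by auto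
qed

text \<open>Infinite descent: norm 0 makes all coordinates divisible by 3, and dividing by 3 keeps
  the norm 0.\<close>

lemma cnorm_eq_0_iff [simp]: "cnorm a = 0 \<longleftrightarrow> a = 0"
proof
  assume "cnorm a = 0"
  then show "a = 0"
  proof (induction "nat \<bar>cf0 a\<bar> + nat \<bar>cf1 a\<bar> + nat \<bar>cf2 a\<bar>" arbitrary: a rule: less_induct)
    case less
    show ?case
    proof (rule ccontr)
      assume nz: "a \<noteq> 0"
      obtain x y z where a: "a = Cub x y z" by (cases a)
      then obtain x' y' z' where xyz: "x = 3 * x'" "y = 3 * y'" "z = 3 * z'"
        using three_dvd_cnorm[of x y z] less.prems by (auto elim!: dvdE)
      have a3: "a = of_int 3 * Cub x' y' z'"
        by (simp add: a xyz of_int_cub cub_mult)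
      then have "cnorm (Cub x' y' z') = 0"
        using less.prems by (simp only: cnorm_mult cnorm_of_int) simp
      moreover have "nat \<bar>x'\<bar> + nat \<bar>y'\<bar> + nat \<bar>z'\<bar> < nat \<bar>x\<bar> + nat \<bar>y\<bar> + nat \<bar>z\<bar>"
      proof -
        have "x' \<noteq> 0 \<or> y' \<noteq> 0 \<or> z' \<noteq> 0" using nz a xyz by (auto simp: zero_cub_def)
        then show ?thesis by (auto simp: xyz abs_mult nat_mult_distrib)
      qed
      ultimately have "Cub x' y' z' = 0" using less.hyps a by simp
      then show False using nz a3 by simp
    qed
  qed
qed (simp add: cnorm_def zero_cub_def)

text \<open>For the real root \<open>t\<close> of the cubic, \<open>evr t\<close> is the real embedding and \<open>evc t\<close> the squared
  absolute value of the complex one; the complex roots are $-t/2\pm i\sqrt{5+3t^2/4}$.\<close>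

definition evr :: "real \<Rightarrow> cub \<Rightarrow> real" where
  "evr t a = of_int (cf0 a) + of_int (cf1 a) * t + of_int (cf2 a) * t\<^sup>2"

definition evc :: "real \<Rightarrow> cub \<Rightarrow> real" where
  "evc t a = (of_int (cf0 a) - of_int (cf1 a) * t / 2 - of_int (cf2 a) * (5 + t\<^sup>2 / 2))\<^sup>2
     + (5 + 3 * t\<^sup>2 / 4) * (of_int (cf1 a) - t * of_int (cf2 a))\<^sup>2"

lemma evr_mult:
  assumes t: "t ^ 3 + 5 * t = 2"
  shows "evr t (a * b) = evr t a * evr t b"
proof -
  have "evr t a * evr t b = evr t (a * b) + (t ^ 3 + 5 * t - 2)
      * (of_int (cf1 a * cf2 b + cf2 a * cf1 b) + of_int (cf2 a * cf2 b) * t)"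
    by (simp add: evr_def times_cub_def) algebra
  then show ?thesis by (simp add: t)
qed

lemma evc_mult:
  assumes t: "t ^ 3 + 5 * t = 2"
  shows "evc t (a * b) = evc t a * evc t b"
proof -
  \<comment> \<open>\<open>U a + i * sqrt W * V a\<close> is the complex embedding of
    \<open>a\<close>. The identities below multiply real and imaginary parts modulo the
    cubic.\<close>
  define U where "U a = of_int (cf0 a) - of_int (cf1 a) * t / 2 - of_int (cf2 a) * (5 + t\<^sup>2 / 2)" for a
  define V where "V a = of_int (cf1 a) - t * of_int (cf2 a)" for a
  define W where "W = 5 + 3 * t\<^sup>2 / 4"
  have "U a * U b - W * V a * V b = U (a * b) + (t ^ 3 + 5 * t - 2)
      * (of_int (cf1 a * cf2 b + cf2 a * cf1 b) - of_int (cf2 a * cf2 b) * t / 2)"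
    by (simp add: U_def V_def W_def times_cub_def field_simps power2_eq_square power3_eq_cube)
  moreover have "U a * V b + V a * U b = V (a * b) + (t ^ 3 + 5 * t - 2) * of_int (cf2 a * cf2 b)"
    by (simp add: U_def V_def W_def times_cub_def field_simps power2_eq_square power3_eq_cube)
  ultimately have UV: "U (a * b) = U a * U b - W * V a * V b" "V (a * b) = U a * V b + V a * U b"
    by (simp_all add: t)
  have E: "evc t c = (U c)\<^sup>2 + W * (V c)\<^sup>2" for c
    by (simp add: evc_def U_def V_def W_def)
  show ?thesis
    unfolding E UV by algebra
qed

lemma evr_evc:
  assumes t: "t ^ 3 + 5 * t = 2"
  shows "evr t a * evc t a = of_int (cnorm a)"
proof (cases a)
  case (Cub x' y' z')
  define x y z where "x = real_of_int x'" "y = real_of_int y'" "z = real_of_int z'"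
  have "evr t a * evc t a = of_int (cnorm a) + (t ^ 3 + 5 * t - 2)
      * (y ^ 3 - 3 * x * y * z + 5 * y * z\<^sup>2 + z ^ 3 * (4 + (t ^ 3 + 5 * t - 2)))"
    unfolding Cub evr_def evc_def cnorm_def
    by (simp flip: x_y_z_def add: field_simps power2_eq_square power3_eq_cube)
  then show ?thesis by (simp add: t)
qed

lemma evc_nonneg: "evc t a \<ge> 0"
  by (auto simp: evc_def intro!: add_nonneg_nonneg mult_nonneg_nonneg)

section \<open>Short elements of the ideal generated by \<open>m - n \<theta>\<close> and
  \<open>s\<close>\<close>

lemma prod_UNIV_3: "(\<Prod>i\<in>UNIV. f i) = f 1 * f 2 * f (3::3)"
  unfolding UNIV_3 by (simp add: mult.assoc)

text \<open>The last hypothesis puts \<beta> in the ideal generated by \<alpha> and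
  \<open>s\<close>. In the square of \<open>\<beta> = \<alpha> A' + s B'\<close>, multiplied by
  \<open>c\<close>, the only term without a visible factor \<alpha> is \<open>c s^2 B'^2\<close>,
  and \<open>c s^2\<close> is the norm of \<alpha>.\<close>

lemma ideal_quotient:
  fixes m n s c :: int
  assumes cop: "coprime n s" and s: "c * s\<^sup>2 = cnorm (Cub m (- n) 0)"
    and nt: "s dvd n * t - m" and b: "s dvd x + y * t + z * t\<^sup>2"
  shows "\<exists>g. of_int c * (Cub x y z)\<^sup>2 = Cub m (- n) 0 * g"
proof -
  define \<alpha> \<beta> where "\<alpha> = Cub m (- n) 0" and "\<beta> = Cub x y z"
  \<comment> \<open>Replace \<open>n t\<close> by \<open>m\<close> modulo \<open>s\<close>, after
    clearing denominators with \<open>n^2\<close>.\<close>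
  have "s dvd n\<^sup>2 * (x + y * t + z * t\<^sup>2) - (n * t - m) * (n * y + z * (n * t + m))"
    using nt b by (intro dvd_diff) auto
  also have "n\<^sup>2 * (x + y * t + z * t\<^sup>2) - (n * t - m) * (n * y + z * (n * t + m))
      = n\<^sup>2 * x + n * m * y + m\<^sup>2 * z"
    by algebra
  finally obtain B where B: "n\<^sup>2 * x + n * m * y + m\<^sup>2 * z = s * B" by (elim dvdE)
  have "coprime (n\<^sup>2) s" using cop by simp
  then obtain u w where uw: "u * n\<^sup>2 + w * s = 1"
    using coprime_iff_gcd_eq_1 bezout_int[of "n\<^sup>2" s] by metis
  \<comment> \<open>The quotient of \<open>n^2 \<beta>\<close> by \<alpha>; the constant remainder
    comes from setting \<open>n \<theta>\<close> to \<open>m\<close>.\<close>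
  define A where "A = Cub (- n * y - m * z) (- n * z) 0"
  have n2: "of_int (n\<^sup>2) * \<beta> = \<alpha> * A + of_int (s * B)"
    unfolding B[symmetric]
    by (simp add: \<alpha>_def \<beta>_def A_def of_int_cub cub_mult plus_cub_def algebra_simps power2_eq_square)
  have "\<beta> = of_int (u * n\<^sup>2 + w * s) * \<beta>" unfolding uw by simp
  also have "\<dots> = of_int u * (of_int (n\<^sup>2) * \<beta>) + of_int (w * s) * \<beta>"
    by (simp add: algebra_simps)
  finally have \<beta>: "\<beta> = \<alpha> * (of_int u * A) + of_int s * (of_int (u * B) + of_int w * \<beta>)"
    unfolding n2 by (simp add: algebra_simps)
  define A' B' where "A' = of_int u * A" and "B' = of_int (u * B) + of_int w * \<beta>"
  have bb: "\<beta> = \<alpha> * A' + of_int s * B'" using \<beta> by (simp add: A'_def B'_def)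
  have cs: "of_int (c * s\<^sup>2) = \<alpha> * cadj \<alpha>"
    unfolding mult_cadj s by (simp add: \<alpha>_def)
  have "of_int c * \<beta>\<^sup>2 = \<alpha> * (of_int c * (\<alpha> * A'\<^sup>2 + 2 * of_int s * A' * B')) + of_int (c * s\<^sup>2) * B'\<^sup>2"
  proof -
    have "of_int c * (\<alpha> * A' + of_int s * B')\<^sup>2 = \<alpha> * (of_int c * (\<alpha> * A'\<^sup>2 + 2 * of_int s * A' * B')) + of_int (c * s\<^sup>2) * B'\<^sup>2"
      by (simp add: algebra_simps power2_eq_square)
    then show ?thesis by (simp only: bb[symmetric])
  qed
  also have "\<dots> = \<alpha> * (of_int c * (\<alpha> * A'\<^sup>2 + 2 * of_int s * A' * B') + cadj \<alpha> * B'\<^sup>2)"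
    unfolding cs by (simp add: algebra_simps)
  finally show ?thesis unfolding \<alpha>_def \<beta>_def by blast
qed

text \<open>The constant is $608=4\cdot 152$, where 152 is the squared covolume of $\mathbb{Z}[\theta]$ in
  $\mathbb{R}\times\mathbb{C}$; the factor 4 comes from inscribing a square in the complex disc.\<close>

lemma small_quotient:
  fixes m n s c :: int and t K :: real
  assumes t: "t ^ 3 + 5 * t = 2" and cop: "coprime m n" and c: "c > 0" and s0: "s \<noteq> 0"
    and s: "c * s\<^sup>2 = cnorm (Cub m (- n) 0)" and K: "K > 0" "c * K ^ 3 > 608"
  shows "\<exists>b g. b \<noteq> 0 \<and> of_int c * b\<^sup>2 = Cub m (- n) 0 * g
    \<and> evr t g \<le> c * K \<and> evc t g \<le> (c * K)\<^sup>2"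
proof -
  define \<alpha> where "\<alpha> = Cub m (- n) 0"
  define e Q where "e = evr t \<alpha>" and "Q = evc t \<alpha>"
  have eQ: "e * Q = c * s\<^sup>2"
    unfolding e_def Q_def evr_evc[OF t] using s by (metis \<alpha>_def of_int_mult of_int_power)
  then have "e * Q > 0" using c s0 by simp
  then have pos: "e > 0" "Q > 0"
    using evc_nonneg[of t \<alpha>] unfolding Q_def by (auto simp: zero_less_mult_iff)
  have cns: "coprime n s"
  proof (rule coprimeI)
    fix d assume d: "d dvd n" "d dvd s"
    have "m ^ 3 = c * s\<^sup>2 - n * (5 * m * n - 2 * n\<^sup>2)"
      unfolding s cnorm_def by (simp add: algebra_simps power2_eq_square power3_eq_cube)
    also have "d dvd \<dots>" using d by (intro dvd_diff) (auto simp: power2_eq_square)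
    finally show "is_unit d"
      using d(1) cop by (meson coprime_common_divisor coprime_power_left_iff coprime_commute coprime_divisors dvd_refl zero_less_numeral)
  qed
  obtain r w where "r * n + w * s = 1"
    using cns bezout_int[of n s] by (metis coprime_iff_gcd_eq_1)
  then have "s dvd n * (r * m) - m"
    by (intro dvdI[of _ _ "- w * m"]) algebra
  then obtain \<tau> where \<tau>: "s dvd n * \<tau> - m" by blast
  define \<omega> where "\<omega> = sqrt (5 + 3 * t\<^sup>2 / 4)"
  have \<omega>: "\<omega>\<^sup>2 = 5 + 3 * t\<^sup>2 / 4" "\<omega> > 0"
    by (auto simp: \<omega>_def add_pos_nonneg)
  \<comment> \<open>The columns are the ideal basis \<open>s\<close>,
    \<open>\<theta> - \<tau>\<close>, \<open>\<theta>^2 - \<tau>^2\<close>; the rows are the real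
    embedding and the real and imaginary parts of the complex one.\<close>
  define A :: "real^3^3" where "A = vector [vector [s, t - \<tau>, t\<^sup>2 - \<tau>\<^sup>2],
      vector [s, - t / 2 - \<tau>, - 5 - t\<^sup>2 / 2 - \<tau>\<^sup>2], vector [0, \<omega>, - \<omega> * t]]"
  \<comment> \<open>The box is scaled by the conjugates of \<alpha>, so that dividing
    \<open>c b^2\<close> by \<alpha> leaves bounds depending on \<open>c\<close> and
    \<open>K\<close> only. The 2 splits \<open>evc t b \<le> K * sqrt Q\<close> evenly between two
    coordinates.\<close>
  define T2 where "T2 = sqrt (K * sqrt Q / 2)"
  define T :: "real^3" where "T = vector [sqrt (K * e), T2, T2]"
  have T2: "T2 > 0" "T2\<^sup>2 = K * sqrt Q / 2"
    using K pos by (auto simp: T2_def)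
  have det: "det A = s * \<omega> * (5 + 3 * t\<^sup>2)"
    unfolding A_def det_3 by (simp add: field_simps power2_eq_square)
  \<comment> \<open>The cubic has discriminant -608, and 152 is a quarter of its absolute
    value.\<close>
  have "(\<omega> * (5 + 3 * t\<^sup>2))\<^sup>2 = 152 + (t ^ 3 + 5 * t - 2) * (27 * t ^ 3 + 135 * t + 54) / 4"
    by (simp add: power_mult_distrib \<omega>(1)) (simp add: field_simps power2_eq_square power3_eq_cube)
  then have w152: "(\<omega> * (5 + 3 * t\<^sup>2))\<^sup>2 = 152" by (simp add: t)
  have "\<bar>det A\<bar>\<^sup>2 = (\<omega> * (5 + 3 * t\<^sup>2))\<^sup>2 * s\<^sup>2"
    by (simp add: det power_mult_distrib)
  then have "\<bar>det A\<bar>\<^sup>2 = 152 * (real_of_int s)\<^sup>2" unfolding w152 by simp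
  also have "\<dots> < (c * K ^ 3) / 4 * (real_of_int s)\<^sup>2" using K s0 by (intro mult_strict_right_mono) auto
  also have "\<dots> = (e * Q) * K ^ 3 / 4" by (simp add: eQ)
  also have "\<dots> = (sqrt (K * e) * T2 * T2)\<^sup>2"
  proof -
    have "(sqrt (K * e) * T2 * T2)\<^sup>2 = (sqrt (K * e))\<^sup>2 * (T2\<^sup>2)\<^sup>2" by algebra
    also have "\<dots> = K * e * (K\<^sup>2 * Q / 4)"
      using K pos by (simp add: T2(2) power_divide power_mult_distrib)
    finally show ?thesis by (simp add: power2_eq_square power3_eq_cube)
  qed
  finally have "\<bar>det A\<bar>\<^sup>2 < (sqrt (K * e) * T2 * T2)\<^sup>2" .
  then have "\<bar>det A\<bar> < sqrt (K * e) * T2 * T2"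
    by (rule power2_less_imp_less) (use K pos T2 in simp)
  then have lt: "\<bar>det A\<bar> < (\<Prod>i\<in>UNIV. T $ i)"
    by (simp add: prod_UNIV_3 T_def)
  have "det A \<noteq> 0"
    using s0 \<omega> by (simp add: det add_pos_nonneg less_imp_neq[symmetric])
  moreover have "T $ i > 0" for i
    using exhaust_3[of i] K pos T2 by (auto simp: T_def)
  ultimately obtain v where v: "v \<noteq> 0" "\<And>i. v $ i \<in> \<int>" "\<And>i. \<bar>(A *v v) $ i\<bar> \<le> T $ i"
    using minkowski_linear_forms lt by blast
  obtain k y z where kyz: "v $ 1 = of_int k" "v $ 2 = of_int y" "v $ 3 = of_int z"
    using v(2) by (metis Ints_cases)
  define x where "x = s * k - \<tau> * y - \<tau>\<^sup>2 * z"
  define b where "b = Cub x y z"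
  have "b \<noteq> 0"
  proof
    assume "b = 0"
    then have "y = 0" "z = 0" "k = 0" using s0 by (auto simp: b_def zero_cub_def x_def)
    then have "v = 0" using kyz by (simp add: vec_eq_iff forall_3)
    then show False using v(1) by simp
  qed
  have "s dvd x + y * \<tau> + z * \<tau>\<^sup>2" by (simp add: x_def algebra_simps)
  from ideal_quotient[OF cns s \<tau> this] obtain g where g: "of_int c * b\<^sup>2 = \<alpha> * g"
    by (auto simp: b_def \<alpha>_def)
  have L1: "(A *v v) $ 1 = evr t b"
    by (simp add: A_def matrix_vector_mult_def sum_3 kyz evr_def b_def x_def algebra_simps)
  have L2: "((A *v v) $ 2)\<^sup>2 + ((A *v v) $ 3)\<^sup>2 = evc t b"
    by (simp add: A_def matrix_vector_mult_def sum_3 kyz evc_def b_def x_def \<omega>(1)[symmetric])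
       (simp add: algebra_simps power2_eq_square)
  have "(evr t b)\<^sup>2 \<le> (T $ 1)\<^sup>2"
    using v(3)[of 1] unfolding L1 by (simp add: abs_le_square_iff[symmetric])
  then have b1: "(evr t b)\<^sup>2 \<le> K * e" using K pos by (simp add: T_def)
  have "((A *v v) $ 2)\<^sup>2 \<le> T2\<^sup>2" "((A *v v) $ 3)\<^sup>2 \<le> T2\<^sup>2"
    using v(3)[of 2] v(3)[of 3] T2 by (simp_all add: T_def abs_le_square_iff[symmetric])
  then have b2: "evc t b \<le> K * sqrt Q" unfolding L2[symmetric] T2 by simp
  have evi: "evr t (of_int c) = c" "evc t (of_int c) = c\<^sup>2"
    by (simp_all add: evr_def evc_def of_int_cub)
  have "evr t (of_int c * b * b) = evr t (\<alpha> * g)" "evc t (of_int c * b * b) = evc t (\<alpha> * g)"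
    using g by (simp_all add: power2_eq_square mult.assoc)
  then have g1: "c * (evr t b)\<^sup>2 = e * evr t g" and g2: "c\<^sup>2 * (evc t b)\<^sup>2 = Q * evc t g"
    unfolding evr_mult[OF t] evc_mult[OF t] evi e_def Q_def by (simp_all add: power2_eq_square)
  have "e * evr t g \<le> e * (c * K)"
    unfolding g1[symmetric] using mult_left_mono[OF b1, of c] c by (simp add: algebra_simps)
  then have "evr t g \<le> c * K" using pos by simp
  moreover have "Q * evc t g \<le> Q * (c * K)\<^sup>2"
  proof -
    have "(evc t b)\<^sup>2 \<le> (K * sqrt Q)\<^sup>2"
      using b2 evc_nonneg[of t b] by (intro power_mono)
    also have "\<dots> = K\<^sup>2 * Q" using pos by (simp add: power_mult_distrib)
    finally have "c\<^sup>2 * (evc t b)\<^sup>2 \<le> c\<^sup>2 * (K\<^sup>2 * Q)" by (intro mult_left_mono) auto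
    then show ?thesis unfolding g2[symmetric] by (simp add: algebra_simps power_mult_distrib)
  qed
  then have "evc t g \<le> (c * K)\<^sup>2" using pos by simp
  ultimately show ?thesis using \<open>b \<noteq> 0\<close> g unfolding \<alpha>_def by blast
qed

section \<open>Finite search\<close>

lemma real_root_bounds:
  "\<exists>t::real. t ^ 3 + 5 * t = 2 \<and> 388/1000 \<le> t \<and> t \<le> 3883/10000"
proof -
  have "\<exists>t\<ge>388/1000. t \<le> 3883/10000 \<and> t ^ 3 + 5 * t = (2::real)"
    by (rule IVT') (auto intro!: continuous_intros simp: power3_eq_cube)
  then show ?thesis by blast
qed

text \<open>The real embedding and the parts \<open>U\<close>, \<open>V\<close> of the complex one
  are bounded separately; solving the linear system for \<open>z\<close> and then \<open>y\<close>
  transfers the bounds. The factor 0.448 exceeds \<open>1 / sqrt 5\<close>.\<close>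

lemma coefficient_bounds:
  fixes t C :: real
  assumes t: "388/1000 \<le> t" "t \<le> 3883/10000" and C: "C \<ge> 0"
    and g1: "0 < evr t (Cub x y z)" "evr t (Cub x y z) \<le> C" and g2: "evc t (Cub x y z) \<le> C\<^sup>2"
  shows "\<bar>real_of_int z\<bar> \<le> 415/1000 * C" "\<bar>real_of_int y\<bar> \<le> 448/1000 * C + 3883/10000 * \<bar>real_of_int z\<bar>"
proof -
  define U V where "U = x - y * t / 2 - z * (5 + t\<^sup>2 / 2)" and "V = y - t * z"
  have q: "U\<^sup>2 + (5 + 3 * t\<^sup>2 / 4) * V\<^sup>2 \<le> C\<^sup>2" using g2 by (simp add: evc_def U_def V_def)
  have "0 \<le> (5 + 3 * t\<^sup>2 / 4) * V\<^sup>2" by (intro mult_nonneg_nonneg) auto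
  then have "U\<^sup>2 \<le> C\<^sup>2" using q by linarith
  then have U: "\<bar>U\<bar> \<le> C" using C abs_le_square_iff[of U C] by simp
  have "5 * V\<^sup>2 \<le> (5 + 3 * t\<^sup>2 / 4) * V\<^sup>2" by (intro mult_right_mono) auto
  then have V5: "5 * V\<^sup>2 \<le> C\<^sup>2" using q zero_le_power2[of U] by linarith
  have "(448/1000 * C)\<^sup>2 = 200704/1000000 * C\<^sup>2" by (simp add: power2_eq_square)
  then have "V\<^sup>2 \<le> (448/1000 * C)\<^sup>2" using V5 zero_le_power2[of C] by linarith
  then have V: "\<bar>V\<bar> \<le> 448/1000 * C" using C abs_le_square_iff[of V "448/1000 * C"] by simp
  have "z * (5 + 3 * t\<^sup>2) = evr t (Cub x y z) - U - 3/2 * t * V"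
    by (simp add: evr_def U_def V_def field_simps power2_eq_square)
  moreover have "\<bar>3/2 * t * V\<bar> \<le> 3/2 * (3883/10000) * (448/1000 * C)"
    unfolding abs_mult using t V by (intro mult_mono) auto
  ultimately have "\<bar>z * (5 + 3 * t\<^sup>2)\<bar> \<le> 2261/1000 * C"
    using g1 U C by linarith
  moreover have "\<bar>real_of_int z\<bar> * 545/100 \<le> \<bar>z * (5 + 3 * t\<^sup>2)\<bar>"
  proof -
    have "(388/1000)\<^sup>2 \<le> t\<^sup>2" using t by (intro power_mono) auto
    then have "545/100 \<le> 5 + 3 * t\<^sup>2" by (simp add: power2_eq_square)
    then have "\<bar>real_of_int z\<bar> * (545/100) \<le> \<bar>real_of_int z\<bar> * (5 + 3 * t\<^sup>2)"
      by (intro mult_left_mono) auto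
    then show ?thesis by (simp add: abs_mult)
  qed
  ultimately show "\<bar>real_of_int z\<bar> \<le> 415/1000 * C" using C by simp
  have "\<bar>t * z\<bar> \<le> 3883/10000 * \<bar>real_of_int z\<bar>"
    unfolding abs_mult using t by (intro mult_right_mono) auto
  moreover have "y = V + t * z" by (simp add: V_def)
  ultimately show "\<bar>real_of_int y\<bar> \<le> 448/1000 * C + 3883/10000 * \<bar>real_of_int z\<bar>"
    using V by linarith
qed

text \<open>An upper bound for 10000 times the real embedding, from $0.388\le t\le 0.3883$.\<close>

definition evr_upper :: "int \<Rightarrow> int \<Rightarrow> int \<Rightarrow> int" where
  "evr_upper x y z = 10000 * x + (if y \<ge> 0 then 3883 else 3880) * y + (if z \<ge> 0 then 1508 else 1505) * z"

lemma evr_upper: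
  fixes t :: real
  assumes t: "388/1000 \<le> t" "t \<le> 3883/10000"
  shows "10000 * evr t (Cub x y z) \<le> evr_upper x y z"
    "- evr_upper (-x) (-y) (-z) \<le> 10000 * evr t (Cub x y z)"
proof -
  have "(388/1000)\<^sup>2 \<le> t\<^sup>2" "t\<^sup>2 \<le> (3883/10000)\<^sup>2" using t by (auto intro!: power_mono)
  then have t2: "1505/10000 \<le> t\<^sup>2" "t\<^sup>2 \<le> 1508/10000" by (simp_all add: power2_eq_square)
  \<comment> \<open>The sign of the coefficient decides which endpoint of the interval gives the
    maximum.\<close>
  have *: "10000 * (real_of_int i * r) \<le> of_int ((if i \<ge> 0 then b else a) * i)"
    if "of_int a / 10000 \<le> r" "r \<le> of_int b / 10000" for i a b r
  proof (cases "i \<ge> 0")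
    case True
    then have "real_of_int i * r \<le> real_of_int i * (of_int b / 10000)"
      using that by (intro mult_left_mono) auto
    then show ?thesis using True by (simp add: mult.commute)
  next
    case False
    then have "real_of_int i * r \<le> real_of_int i * (of_int a / 10000)"
      using that by (intro mult_left_mono_neg) auto
    then show ?thesis using False by (simp add: mult.commute)
  qed
  have up: "10000 * evr t (Cub u v w) \<le> evr_upper u v w" for u v w
    using *[of 3880 t 3883 v] *[of 1505 "t\<^sup>2" 1508 w] t t2 by (simp add: evr_def evr_upper_def)
  show "10000 * evr t (Cub x y z) \<le> evr_upper x y z" by (rule up)
  show "- evr_upper (-x) (-y) (-z) \<le> 10000 * evr t (Cub x y z)"
    using up[of "-x" "-y" "-z"] by (simp add: evr_def)
qed

text \<open>Each entry $(\gamma,\kappa,\eta)$ certifies $4\gamma\kappa=\eta^2$, so $\gamma$ and $\kappa$ have the same square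
  class; only four values of $\kappa$ occur.\<close>

definition class_table :: "(cub \<times> cub \<times> cub) list" where
  "class_table = [
   (Cub (1) (-2) (-1), Cub (1) (0) (0), Cub (0) (1) (1)),
   (Cub (-1) (3) (-1), Cub (1) (0) (0), Cub (0) (1) (-1)),
   (Cub (1) (-1) (0), Cub (1) (-1) (0), Cub (2) (-2) (0)),
   (Cub (2) (-1) (0), Cub (1) (0) (0), Cub (2) (1) (1)),
   (Cub (1) (0) (0), Cub (1) (0) (0), Cub (2) (0) (0)),
   (Cub (4) (0) (0), Cub (1) (0) (0), Cub (4) (0) (0)),
   (Cub (0) (2) (0), Cub (1) (0) (0), Cub (2) (-1) (1)),
   (Cub (2) (2) (0), Cub (0) (1) (1), Cub (4) (-4) (0)),
   (Cub (1) (3) (0), Cub (1) (-1) (0), Cub (2) (0) (2)),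
   (Cub (2) (-3) (1), Cub (1) (-1) (0), Cub (0) (4) (0)),
   (Cub (1) (-2) (1), Cub (1) (0) (0), Cub (2) (-2) (0)),
   (Cub (6) (-1) (1), Cub (0) (1) (1), Cub (4) (-2) (2)),
   (Cub (0) (0) (1), Cub (1) (0) (0), Cub (0) (2) (0)),
   (Cub (3) (0) (1), Cub (1) (-1) (0), Cub (2) (2) (0)),
   (Cub (5) (0) (1), Cub (1) (0) (0), Cub (4) (1) (1)),
   (Cub (0) (1) (1), Cub (0) (1) (1), Cub (0) (2) (2)),
   (Cub (3) (1) (1), Cub (1) (0) (0), Cub (4) (-1) (1)),
   (Cub (4) (1) (1), Cub (4) (1) (1), Cub (8) (2) (2)),
   (Cub (6) (1) (1), Cub (1) (-1) (0), Cub (4) (0) (0)),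
   (Cub (1) (2) (1), Cub (1) (0) (0), Cub (2) (2) (0)),
   (Cub (6) (3) (1), Cub (4) (1) (1), Cub (12) (-2) (2)),
   (Cub (4) (4) (1), Cub (1) (0) (0), Cub (4) (2) (0)),
   (Cub (8) (0) (2), Cub (1) (0) (0), Cub (6) (-1) (1)),
   (Cub (4) (2) (2), Cub (1) (-1) (0), Cub (4) (-2) (2)),
   (Cub (2) (0) (-2), Cub (4) (1) (1), Cub (4) (4) (0)),
   (Cub (7) (-2) (-1), Cub (1) (-1) (0), Cub (2) (4) (2)),
   (Cub (4) (-4) (0), Cub (1) (-1) (0), Cub (4) (-4) (0)),
   (Cub (8) (-4) (0), Cub (1) (0) (0), Cub (4) (2) (2)),
   (Cub (9) (2) (1), Cub (1) (0) (0), Cub (6) (0) (2)),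
   (Cub (9) (6) (1), Cub (1) (0) (0), Cub (6) (2) (0)),
   (Cub (10) (-4) (2), Cub (4) (1) (1), Cub (12) (0) (4)),
   (Cub (12) (0) (4), Cub (1) (-1) (0), Cub (4) (4) (0)),
   (Cub (12) (2) (4), Cub (1) (0) (0), Cub (6) (3) (1))]"

lemma class_table: "list_all (\<lambda>(g, \<kappa>, \<eta>). Cub 4 0 0 * g * \<kappa> = \<eta> * \<eta>) class_table"
  unfolding class_table_def list.pred_inject prod.case cub_mult
  by (intro conjI TrueI) simp_all
text \<open>The candidates to be excluded by primes of degree two above 5 and 11 instead of by their
  square class.\<close>

definition exceptional :: "cub list" where
  "exceptional = [Cub 1 2 (-1), Cub 4 (-2) 1, Cub 9 (-2) 1, Cub 3 (-3) 1]"



lemma upto_lists: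
  "[-3..3::int] = [-3, -2, -1, 0, 1, 2, 3]"
  "[-4..4::int] = [-4, -3, -2, -1, 0, 1, 2, 3, 4]"
  "[-3..11::int] = [-3, -2, -1, 0, 1, 2, 3, 4, 5, 6, 7, 8, 9, 10, 11]"
  "[-5..5::int] = [-5, -4, -3, -2, -1, 0, 1, 2, 3, 4, 5]"
  "[-3..6::int] = [-3, -2, -1, 0, 1, 2, 3, 4, 5, 6]"
  by (simp_all add: upto_rec1)

text \<open>With bound $C$ on the conjugates, $N(\gamma)=\gamma_1|\gamma_2|^2\le C^2\gamma_1$. Here $C=8.48$ for $c=1$ and
  $C=13.46$ for $c=2$; the numerals are $10^4C$ and $10^4C^2$.\<close>

definition search1 :: "int \<Rightarrow> int \<Rightarrow> int \<Rightarrow> bool" where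
  "search1 z y x = (if 84800 < - evr_upper (-x) (-y) (-z) then True
     else if 719104 * evr_upper x y z < 100000000 * cnorm (Cub x y z) then True
     else if cnorm (Cub x y z) \<in> {1, 4, 9, 16, 25, 36, 49, 64, 81, 100, 121, 144, 169, 196, 225, 256, 289, 324, 361, 400, 441, 484, 529, 576}
     then Cub x y z \<in> set exceptional \<union> set (map fst class_table) else True)"

lemma search1:
  assumes "z \<in> {-3..3}" "y \<in> {-4..4}" "x \<in> {-3..11}"
  shows "search1 z y x"
proof -
  have "list_all (\<lambda>z. list_all (\<lambda>y. list_all (search1 z y) [-3..11]) [-4..4]) [-3..3]"
    unfolding upto_lists list.pred_inject
    by (intro conjI TrueI; simp add: search1_def evr_upper_def cnorm_def exceptional_def class_table_def)
  then show ?thesis using assms unfolding list_all_iff set_upto by blast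
qed

definition search2 :: "int \<Rightarrow> int \<Rightarrow> int \<Rightarrow> bool" where
  "search2 z y x = (if 134600 < - evr_upper (-x) (-y) (-z) then True
     else if 1811716 * evr_upper x y z < 100000000 * cnorm (Cub x y z) then True
     else if cnorm (Cub x y z) \<in> {1, 4, 9, 16, 25, 36, 49, 64, 81, 100, 121, 144, 169, 196, 225, 256, 289, 324, 361, 400, 441, 484, 529, 576, 625, 676, 729, 784, 841, 900, 961, 1024, 1089, 1156, 1225, 1296, 1369, 1444, 1521, 1600, 1681, 1764, 1849, 1936, 2025, 2116, 2209, 2304, 2401}
     then Cub x y z \<in> {Cub 9 (-2) 1} \<union> set (map fst class_table) else True)"

text \<open>For \<open>c = 2\<close> the candidates satisfy \<open>y\<close> even and
  \<open>x\<close> congruent to \<open>z\<close> modulo 4. Enumerating only these keeps the larger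
  box manageable.\<close>

lemma search2:
  assumes "z \<in> {-5..5}" "y \<in> {-3..3}" "x \<in> {-3..6}"
  shows "search2 z (2 * y) (z + 4 * x)"
proof -
  have "list_all (\<lambda>z. list_all (\<lambda>y. list_all (\<lambda>x. search2 z (2 * y) (z + 4 * x)) [-3..6]) [-3..3]) [-5..5]"
    unfolding upto_lists list.pred_inject
    by (intro conjI TrueI; simp add: search2_def evr_upper_def cnorm_def class_table_def)
  then show ?thesis using assms unfolding list_all_iff set_upto by blast
qed

section \<open>Excluded square classes\<close>

lemma of_int_dvd_cub: "of_int k dvd Cub x y z \<longleftrightarrow> k dvd x \<and> k dvd y \<and> k dvd z"
proof
  assume "of_int k dvd Cub x y z"
  then obtain w where "Cub x y z = of_int k * w" by (elim dvdE)
  then show "k dvd x \<and> k dvd y \<and> k dvd z" by (cases w) (simp add: of_int_cub cub_mult)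
next
  assume "k dvd x \<and> k dvd y \<and> k dvd z"
  then obtain x' y' z' where "x = k * x'" "y = k * y'" "z = k * z'" by (auto elim!: dvdE)
  then have "Cub x y z = of_int k * Cub x' y' z'" by (simp add: of_int_cub cub_mult)
  then show "of_int k dvd Cub x y z" by simp
qed

lemma of_int_mult_cancel_cub:
  "k \<noteq> 0 \<Longrightarrow> of_int k * a = of_int k * b \<Longrightarrow> a = (b :: cub)"
  by (cases a; cases b) (simp add: of_int_cub cub_mult)

lemma coprime_of_int_dvd_cub:
  assumes "coprime k l" "of_int k dvd of_int l * (w :: cub)"
  shows "of_int k dvd w"
  using assms by (cases w) (auto simp: of_int_cub[of l] cub_mult of_int_dvd_cub coprime_dvd_mult_right_iff)

text \<open>Here \<open>r\<close> is the only root of the cubic modulo \<open>p\<close> and $\gamma$ generates, up to units at \<open>p\<close>, the prime of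
  degree two above \<open>p\<close>. By parity that prime divides $m-\theta n$, which forces \<open>p\<close> to divide \<open>m\<close> and \<open>n\<close>.\<close>

lemma degree_two_prime_contradiction:
  fixes p r m n c :: int
  assumes "prime p" and c: "\<not> p dvd c" and cop: "coprime m n"
    and reduced: "\<And>w. of_int p dvd (w :: cub)\<^sup>2 \<Longrightarrow> of_int p dvd w"
    and eq: "of_int c * b\<^sup>2 = Cub m (- n) 0 * g"
    and g: "g * Cub (- r) 1 0 = of_int p * h" and h: "\<not> p dvd cnorm h"
  shows False
proof -
  define \<alpha> \<pi> where "\<alpha> = Cub m (- n) 0" and "\<pi> = Cub (- r) 1 0"
  have p0: "p \<noteq> 0" using \<open>prime p\<close> by auto
  have cp: "coprime p c" "coprime p (cnorm h)"
    using \<open>prime p\<close> c h by (auto intro: prime_imp_coprime)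
  have 1: "of_int c * (b * \<pi>)\<^sup>2 = of_int p * (\<alpha> * h * \<pi>)"
  proof -
    have "of_int c * (b * \<pi>)\<^sup>2 = (of_int c * b\<^sup>2) * \<pi>\<^sup>2" by (simp add: algebra_simps power_mult_distrib)
    also have "\<dots> = \<alpha> * (g * \<pi>) * \<pi>" unfolding eq \<alpha>_def by (simp add: algebra_simps power2_eq_square)
    also have "\<dots> = of_int p * (\<alpha> * h * \<pi>)" unfolding \<pi>_def g by (simp add: algebra_simps)
    finally show ?thesis .
  qed
  then have "of_int p dvd of_int c * (b * \<pi>)\<^sup>2" by simp
  then have "of_int p dvd b * \<pi>" using coprime_of_int_dvd_cub[OF cp(1)] reduced by blast
  then obtain w where w: "b * \<pi> = of_int p * w" by (elim dvdE)
  have "of_int p * (of_int p * (of_int c * w\<^sup>2)) = of_int p * (\<alpha> * h * \<pi>)"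
    using 1 unfolding w by (simp add: algebra_simps power2_eq_square)
  then have "of_int p * (of_int c * w\<^sup>2) = \<alpha> * h * \<pi>" using of_int_mult_cancel_cub[OF p0] by blast
  \<comment> \<open>Multiplying by \<open>cadj h\<close> replaces \<open>h\<close> by its norm,
    which is invertible modulo \<open>p\<close>.\<close>
  then have "of_int p dvd (\<alpha> * h * \<pi>) * cadj h" by (metis dvd_triv_left dvd_mult2)
  also have "(\<alpha> * h * \<pi>) * cadj h = of_int (cnorm h) * (\<alpha> * \<pi>)"
    using mult_cadj[of h] by (metis mult.assoc mult.commute)
  finally have "of_int p dvd \<alpha> * \<pi>" by (rule coprime_of_int_dvd_cub[OF cp(2)])
  \<comment> \<open>These are the coefficients of \<theta> and \<open>\<theta>^2\<close> in
    \<open>(m - n \<theta>) (\<theta> - r)\<close>, up to sign.\<close>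
  then have "p dvd m + n * r" "p dvd n"
    by (auto simp: \<alpha>_def \<pi>_def cub_mult of_int_dvd_cub algebra_simps)
  then have "p dvd m" by (simp add: dvd_add_left_iff)
  with \<open>p dvd n\<close> cop have "is_unit p" by (meson coprime_common_divisor)
  with \<open>prime p\<close> show False by auto
qed

lemma Cub_square:
  "(Cub x y z)\<^sup>2 = Cub (x*x + 4*y*z) (2*x*y - 10*y*z + 2*z*z) (y*y + 2*x*z - 5*z*z)"
  by (simp add: power2_eq_square cub_mult algebra_simps)

text \<open>Away from the discriminant the cubic is separable modulo \<open>p\<close>, so the
  quotient ring has no nilpotents. The proof is an explicit elimination.\<close>

lemma cub_reduced_mod_prime:
  fixes p :: int
  assumes p: "prime p" "\<not> p dvd 608" and sq: "of_int p dvd (w :: cub)\<^sup>2"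
  shows "of_int p dvd w"
proof (cases w)
  case (Cub x y z)
  define A B D where "A = x*x + 4*y*z" and "B = 2*x*y - 10*y*z + 2*z*z" and "D = y*y + 2*x*z - 5*z*z"
  have dvd: "p dvd A" "p dvd B" "p dvd D"
    using sq by (auto simp: Cub Cub_square of_int_dvd_cub A_def B_def D_def)
  have "608 * z ^ 6 = (25*y*z\<^sup>2 - 54*z^3 - 3*y^3) * (y * D - z * B)
      + (20*z\<^sup>2 + 3*y\<^sup>2) * (4*z\<^sup>2 * A + D * (D - 4*x*z))"
    \<comment> \<open>\<open>y D - z B\<close> and \<open>4 z^2 A + D (D - 4 x z)\<close> are free
      of \<open>x\<close>; the outer cofactors then eliminate \<open>y\<close>.\<close>
    unfolding A_def B_def D_def by algebra
  also have "p dvd \<dots>"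
  proof -
    have "p dvd y * D - z * B" using dvd by (intro dvd_diff dvd_mult)
    moreover have "p dvd 4 * z\<^sup>2 * A + D * (D - 4 * x * z)" using dvd by (intro dvd_add dvd_mult dvd_mult2)
    ultimately show ?thesis by (rule dvd_add[OF dvd_mult dvd_mult])
  qed
  finally have "p dvd 608 * z ^ 6" .
  then have z: "p dvd z" using p prime_dvd_multD[of p 608 "z ^ 6"] prime_dvd_power[of p z 6] by blast
  have "y * y = D - z * (2 * x - 5 * z)" by (simp add: D_def algebra_simps)
  also have "p dvd \<dots>" using dvd z by (intro dvd_diff) auto
  finally have y: "p dvd y" using p(1) by (simp add: prime_dvd_mult_iff)
  have "x * x = A - z * (4 * y)" by (simp add: A_def algebra_simps)
  also have "p dvd \<dots>" using dvd z by (intro dvd_diff) auto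
  finally have "p dvd x" using p(1) by (simp add: prime_dvd_mult_iff)
  with y z show ?thesis by (simp add: Cub of_int_dvd_cub)
qed

section \<open>Dyadic obstructions to the nontrivial square classes\<close>

text \<open>The conditions say that \<open>\<kappa> b^2\<close> has the form
  \<open>m - n \<theta>\<close> with \<open>m - 2 n\<close> a square. Both are homogeneous quadratic
  in \<open>b\<close>, so an even solution can be halved, and only 0 survives endless
  halving.\<close>

lemma infinite_descent_mod_2:
  assumes step: "\<And>x y z d. cf2 (\<kappa> * (Cub x y z)\<^sup>2) = 0 \<Longrightarrow>
      cf0 (\<kappa> * (Cub x y z)\<^sup>2) + 2 * cf1 (\<kappa> * (Cub x y z)\<^sup>2) = d\<^sup>2 \<Longrightarrow> even x \<and> even y \<and> even z"
    and "cf2 (\<kappa> * b\<^sup>2) = 0" "cf0 (\<kappa> * b\<^sup>2) + 2 * cf1 (\<kappa> * b\<^sup>2) = d\<^sup>2"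
  shows "b = 0"
  using assms(2,3)
proof (induction "nat \<bar>cf0 b\<bar> + nat \<bar>cf1 b\<bar> + nat \<bar>cf2 b\<bar>" arbitrary: b d rule: less_induct)
  case less
  obtain x y z where b: "b = Cub x y z" by (cases b)
  have "even x \<and> even y \<and> even z" using step less.prems b by blast
  then obtain x' y' z' where xyz: "x = 2 * x'" "y = 2 * y'" "z = 2 * z'" by (auto elim!: evenE)
  define b' where "b' = Cub x' y' z'"
  obtain u v w where uvw: "\<kappa> * b'\<^sup>2 = Cub u v w" by (cases "\<kappa> * b'\<^sup>2")
  have b2: "b = of_int 2 * b'" by (simp add: b b'_def xyz of_int_cub cub_mult)
  then have "\<kappa> * b\<^sup>2 = of_int 4 * (\<kappa> * b'\<^sup>2)" by (simp add: algebra_simps power2_eq_square)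
  then have 4: "\<kappa> * b\<^sup>2 = Cub (4 * u) (4 * v) (4 * w)" by (simp only: uvw of_int_cub) (simp add: cub_mult)
  then have d: "4 * (u + 2 * v) = d\<^sup>2" and w: "w = 0" using less.prems by simp_all
  from d have "even (d\<^sup>2)" by (metis dvd_mult2 even_numeral)
  then obtain d' where "d = 2 * d'" by auto
  then have d': "u + 2 * v = d'\<^sup>2" using d by simp
  show ?case
  proof (rule ccontr)
    assume nz: "b \<noteq> 0"
    then have "x' \<noteq> 0 \<or> y' \<noteq> 0 \<or> z' \<noteq> 0" using b xyz by (auto simp: zero_cub_def)
    then have "nat \<bar>x'\<bar> + nat \<bar>y'\<bar> + nat \<bar>z'\<bar> < nat \<bar>x\<bar> + nat \<bar>y\<bar> + nat \<bar>z\<bar>"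
      by (auto simp: xyz abs_mult nat_mult_distrib)
    then have "b' = 0" using less.hyps[of b' d'] uvw w d' by (simp add: b b'_def)
    then show False using nz b2 by simp
  qed
qed

lemma parity_mod_16:
  fixes x :: int
  shows "odd x \<Longrightarrow> x mod 16 \<in> set [1, 3, 5, 7, 9, 11, 13, 15]"
    and "even x \<Longrightarrow> x mod 16 \<in> set [0, 2, 4, 6, 8, 10, 12, 14]"
proof -
  have "x mod 16 \<in> set [0..15]" unfolding set_upto by simp
  also have "[0..15::int] = [0, 1, 2, 3, 4, 5, 6, 7, 8, 9, 10, 11, 12, 13, 14, 15]"
    by (simp add: upto_rec1)
  finally have r: "x mod 16 \<in> set [0, 1, 2, 3, 4, 5, 6, 7, 8, 9, 10, 11, 12, 13, 14, 15]" .
  have "even (x mod 16) \<longleftrightarrow> even x" by presburger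
  then show "odd x \<Longrightarrow> x mod 16 \<in> set [1, 3, 5, 7, 9, 11, 13, 15]"
    and "even x \<Longrightarrow> x mod 16 \<in> set [0, 2, 4, 6, 8, 10, 12, 14]"
    using r by auto
qed

lemma square_mod_16: "(d::int)\<^sup>2 mod 16 \<in> {0, 1, 4, 9}"
proof -
  have "(d mod 16)\<^sup>2 mod 16 \<in> {0, 1, 4, 9}"
    using parity_mod_16(2)[of d] parity_mod_16(1)[of d] by (cases "even d") (auto simp: power2_eq_square)
  then show ?thesis by (simp add: power_mod)
qed

text \<open>The units modulo 16 have exponent 4, so \<open>y^3\<close> inverts
  \<open>y\<close>.\<close>

lemma odd_inverse_mod_16: "odd (y::int) \<Longrightarrow> \<exists>j. odd j \<and> (j * y) mod 16 = 1"
proof -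
  assume "odd y"
  then have "(y mod 16) ^ 4 mod 16 = 1" using parity_mod_16(1)[of y] by auto
  then have "y ^ 4 mod 16 = 1" by (simp only: power_mod)
  then have "y ^ 3 * y mod 16 = 1" by (simp add: power4_eq_xxxx power3_eq_cube)
  then show ?thesis using \<open>odd y\<close> by (intro exI[of _ "y ^ 3"]) simp
qed

lemma square_mod_4: "(d::int)\<^sup>2 mod 4 = 0 \<or> d\<^sup>2 mod 4 = 1"
proof (cases "even d")
  case True
  then obtain k where "d = 2 * k" by blast
  then show ?thesis by simp
next
  case False
  then obtain k where "d = 2 * k + 1" by (elim oddE)
  then have "d\<^sup>2 = 4 * (k * k + k) + 1" by (simp add: power2_eq_square algebra_simps)
  then have "d\<^sup>2 mod 4 = (4 * (k * k + k) + 1) mod 4" by simp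
  also have "\<dots> = 1" by (subst mod_mult_self4) simp
  finally show ?thesis ..
qed

lemma residue_mod_4_contradiction:
  "(a::int) mod 4 = 0 \<or> a mod 4 = 1 \<Longrightarrow> a = 4 * b + r \<Longrightarrow> r = 2 \<or> r = 3 \<Longrightarrow> False"
  by presburger

text \<open>A ternary quadratic form with its coefficients as parameters, so that reduction and
  scaling are proved once for the six forms below.\<close>

definition tqf :: "int \<Rightarrow> int \<Rightarrow> int \<Rightarrow> int \<Rightarrow> int \<Rightarrow> int \<Rightarrow> int \<Rightarrow> int \<Rightarrow> int \<Rightarrow> int" where
  "tqf a b c d e f x y z = a*x*x + b*y*y + c*z*z + d*x*y + e*x*z + f*y*z"

lemma tqf_mod: "tqf a b c d e f x y z mod k = tqf a b c d e f (x mod k) (y mod k) (z mod k) mod k"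
  unfolding tqf_def by (intro mod_add_cong mod_mult_cong refl; simp)

lemma tqf_scale: "tqf a b c d e f (j * x) (j * y) (j * z) = j\<^sup>2 * tqf a b c d e f x y z"
  unfolding tqf_def by algebra

text \<open>Scaling by an inverse of \<open>y\<close> modulo 16 reduces the search to \<open>y = 1\<close>.\<close>

lemma dyadic_obstruction:
  fixes x y z r :: int
  assumes zero: "tqf a b c d e f x y z = 0" and sq: "tqf a' b' c' d' e' f' x y z = r\<^sup>2"
    and "even x" "odd z"
    and check: "list_all (\<lambda>x. list_all (\<lambda>z. tqf a b c d e f x 1 z mod 16 = 0 \<longrightarrow>
        tqf a' b' c' d' e' f' x 1 z mod 16 \<notin> {0, 1, 4, 9})
      [1, 3, 5, 7, 9, 11, 13, 15]) [0, 2, 4, 6, 8, 10, 12, 14]"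
  shows "even y"
proof (rule ccontr)
  assume "odd y"
  then obtain j where j: "odd j" "(j * y) mod 16 = 1" using odd_inverse_mod_16 by blast
  have "tqf a b c d e f (j * x mod 16) 1 (j * z mod 16) mod 16 = 0"
    using tqf_mod[of a b c d e f "j * x" "j * y" "j * z" 16] by (simp add: tqf_scale zero j)
  moreover have "tqf a' b' c' d' e' f' (j * x mod 16) 1 (j * z mod 16) mod 16 \<in> {0, 1, 4, 9}"
    using tqf_mod[of a' b' c' d' e' f' "j * x" "j * y" "j * z" 16] square_mod_16[of "j * r"]
    by (simp add: tqf_scale sq j power_mult_distrib)
  moreover have "j * x mod 16 \<in> set [0, 2, 4, 6, 8, 10, 12, 14]" "j * z mod 16 \<in> set [1, 3, 5, 7, 9, 11, 13, 15]"
    using parity_mod_16(2)[of "j * x"] parity_mod_16(1)[of "j * z"] \<open>even x\<close> \<open>odd z\<close> j by simp_all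
  ultimately show False using bspec[OF bspec[OF check[unfolded list_all_iff]]] by metis
qed

text \<open>The square condition modulo 4 makes \<open>x\<close> even, the vanishing form modulo 2
  gives \<open>y\<close> and \<open>z\<close> equal parity, and the search modulo 16 excludes both
  being odd. The next two classes follow the same pattern.\<close>

lemma square_class_excluded_1:
  assumes "cf2 (Cub 1 (-1) 0 * b\<^sup>2) = 0"
    and "cf0 (Cub 1 (-1) 0 * b\<^sup>2) + 2 * cf1 (Cub 1 (-1) 0 * b\<^sup>2) = d\<^sup>2"
  shows "b = 0"
proof (rule infinite_descent_mod_2[OF _ assms])
  fix x y z d :: int
  let ?v = "Cub 1 (-1) 0 * (Cub x y z)\<^sup>2"
  assume "cf2 ?v = 0" "cf0 ?v + 2 * cf1 ?v = d\<^sup>2"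
  then have q: "tqf 0 1 (-7) (-2) 2 10 x y z = 0" "tqf (-1) 8 (-36) 4 16 (-24) x y z = d\<^sup>2"
    by (simp_all add: tqf_def Cub_square cub_mult algebra_simps)
  have ev: "even x"
  proof (rule ccontr)
    assume "odd x"
    then obtain k where "x = 2 * k + 1" by (elim oddE)
    then have "d\<^sup>2 = 4 * (2*y*y - 9*z*z + x*y + 4*x*z - 6*y*z - k*k - k - 1) + 3"
      unfolding q(2)[symmetric] tqf_def by (simp add: algebra_simps)
    then show False using residue_mod_4_contradiction[OF square_mod_4] by blast
  qed
  have "even (tqf 0 1 (-7) (-2) 2 10 x y z)" using q(1) by simp
  then have "even y \<longleftrightarrow> even z" using ev by (simp add: tqf_def)
  moreover have "odd z \<Longrightarrow> even y"
    by (rule dyadic_obstruction[OF q ev]) (assumption, simp add: tqf_def)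
  ultimately show "even x \<and> even y \<and> even z" using ev by blast
qed

lemma square_class_excluded_2:
  assumes "cf2 (Cub 0 1 1 * b\<^sup>2) = 0"
    and "cf0 (Cub 0 1 1 * b\<^sup>2) + 2 * cf1 (Cub 0 1 1 * b\<^sup>2) = d\<^sup>2"
  shows "b = 0"
proof (rule infinite_descent_mod_2[OF _ assms])
  fix x y z d :: int
  let ?v = "Cub 0 1 1 * (Cub x y z)\<^sup>2"
  assume "cf2 ?v = 0" "cf0 ?v + 2 * cf1 ?v = d\<^sup>2"
  then have q: "tqf 1 (-5) 27 2 (-10) (-6) x y z = 0" "tqf 2 (-4) 4 (-16) (-8) 88 x y z = d\<^sup>2"
    by (simp_all add: tqf_def Cub_square cub_mult algebra_simps)
  have ev: "even x"
  proof (rule ccontr)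
    assume "odd x"
    then obtain k where "x = 2 * k + 1" by (elim oddE)
    then have "d\<^sup>2 = 4 * (2*k*k + 2*k - y*y + z*z - 4*x*y - 2*x*z + 22*y*z) + 2"
      unfolding q(2)[symmetric] tqf_def by (simp add: algebra_simps)
    then show False using residue_mod_4_contradiction[OF square_mod_4] by blast
  qed
  have "even (tqf 1 (-5) 27 2 (-10) (-6) x y z)" using q(1) by simp
  then have "even y \<longleftrightarrow> even z" using ev by (simp add: tqf_def)
  moreover have "odd z \<Longrightarrow> even y"
    by (rule dyadic_obstruction[OF q ev]) (assumption, simp add: tqf_def)
  ultimately show "even x \<and> even y \<and> even z" using ev by blast
qed

lemma square_class_excluded_3:
  assumes "cf2 (Cub 4 1 1 * b\<^sup>2) = 0"
    and "cf0 (Cub 4 1 1 * b\<^sup>2) + 2 * cf1 (Cub 4 1 1 * b\<^sup>2) = d\<^sup>2"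
  shows "b = 0"
proof (rule infinite_descent_mod_2[OF _ assms])
  fix x y z d :: int
  let ?v = "Cub 4 1 1 * (Cub x y z)\<^sup>2"
  assume "cf2 ?v = 0" "cf0 ?v + 2 * cf1 ?v = d\<^sup>2"
  then have q: "tqf 1 (-1) 7 2 (-2) (-6) x y z = 0" "tqf 6 (-4) 20 0 (-8) 24 x y z = d\<^sup>2"
    by (simp_all add: tqf_def Cub_square cub_mult algebra_simps)
  have ev: "even x"
  proof (rule ccontr)
    assume "odd x"
    then obtain k where "x = 2 * k + 1" by (elim oddE)
    then have "d\<^sup>2 = 4 * (6*k*k + 6*k + 1 - y*y + 5*z*z - 2*x*z + 6*y*z) + 2"
      unfolding q(2)[symmetric] tqf_def by (simp add: algebra_simps)
    then show False using residue_mod_4_contradiction[OF square_mod_4] by blast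
  qed
  have "even (tqf 1 (-1) 7 2 (-2) (-6) x y z)" using q(1) by simp
  then have "even y \<longleftrightarrow> even z" using ev by (simp add: tqf_def)
  moreover have "odd z \<Longrightarrow> even y"
    by (rule dyadic_obstruction[OF q ev]) (assumption, simp add: tqf_def)
  ultimately show "even x \<and> even y \<and> even z" using ev by blast
qed

section \<open>The two-descent\<close>

text \<open>Taking norms gives \<open>c^3 N(b)^2 = c s^2 N(g)\<close>. That \<open>N(g)\<close> is a
  square is a strong filter for the search.\<close>

lemma cnorm_quotient_square:
  fixes m n s c :: int
  assumes c: "c > 0" and s0: "s \<noteq> 0" and s: "c * s\<^sup>2 = cnorm (Cub m (- n) 0)"
    and b: "b \<noteq> 0" and eq: "of_int c * b\<^sup>2 = Cub m (- n) 0 * g"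
  shows "\<exists>k>0. cnorm g = k\<^sup>2"
proof -
  have "cnorm (of_int c * b\<^sup>2) = cnorm (Cub m (- n) 0 * g)" by (simp only: eq)
  then have "c * (c * cnorm b)\<^sup>2 = c * (s\<^sup>2 * cnorm g)"
    by (simp add: cnorm_mult power2_eq_square power3_eq_cube s[symmetric] algebra_simps)
  then have sq: "(c * cnorm b)\<^sup>2 = s\<^sup>2 * cnorm g" using c by simp
  then have "s\<^sup>2 dvd (c * cnorm b)\<^sup>2" by simp
  then have "s dvd c * cnorm b" by simp
  then obtain k where k: "c * cnorm b = s * k" by (elim dvdE)
  then have "cnorm g = k\<^sup>2" using sq s0 by (simp add: power_mult_distrib)
  moreover have "k \<noteq> 0" using k c b by auto
  ultimately show ?thesis by (intro exI[of _ "\<bar>k\<bar>"]) auto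
qed

text \<open>The norm is positive, hence so is the real embedding. The last bound holds because the
  norm is \<open>evr\<close> times \<open>evc\<close>, at most \<open>C^2\<close> times
  \<open>evr\<close>. All bounds are in a form that can be rounded to integers.\<close>

lemma quotient_region:
  fixes t C :: real and x y z k :: int
  assumes t: "t ^ 3 + 5 * t = 2" "388/1000 \<le> t" "t \<le> 3883/10000" and C: "C > 0"
    and k: "k > 0" "cnorm (Cub x y z) = k\<^sup>2"
    and g: "evr t (Cub x y z) \<le> C" "evc t (Cub x y z) \<le> C\<^sup>2"
  shows "\<bar>real_of_int z\<bar> \<le> 415/1000 * C"
    and "\<bar>real_of_int y\<bar> \<le> 448/1000 * C + 3883/10000 * \<bar>real_of_int z\<bar>"
    and "- (3883/10000 * \<bar>real_of_int y\<bar> + 1508/10000 * \<bar>real_of_int z\<bar>) \<le> x"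
    and "x \<le> C + 3883/10000 * \<bar>real_of_int y\<bar> + 1508/10000 * \<bar>real_of_int z\<bar>"
    and "real_of_int k ^ 2 \<le> C ^ 3"
    and "- evr_upper (- x) (- y) (- z) \<le> 10000 * C"
    and "10000 * cnorm (Cub x y z) \<le> C\<^sup>2 * evr_upper x y z"
proof -
  let ?r = "evr t (Cub x y z)" and ?q = "evc t (Cub x y z)"
  have rq: "?r * ?q = real_of_int k ^ 2" using evr_evc[OF t(1), of "Cub x y z"] k by simp
  then have "?r * ?q > 0" using k by simp
  then have r: "?r > 0" using evc_nonneg[of t "Cub x y z"] by (auto simp: zero_less_mult_iff)
  show "\<bar>real_of_int z\<bar> \<le> 415/1000 * C"
    "\<bar>real_of_int y\<bar> \<le> 448/1000 * C + 3883/10000 * \<bar>real_of_int z\<bar>"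
    using coefficient_bounds[OF t(2,3) _ r g] C by auto
  have "t\<^sup>2 \<le> (3883/10000)\<^sup>2" using t by (intro power_mono) auto
  then have "\<bar>real_of_int z * t\<^sup>2\<bar> \<le> \<bar>real_of_int z\<bar> * (1508/10000)"
    unfolding abs_mult by (intro mult_left_mono) (auto simp: power2_eq_square)
  moreover have "\<bar>real_of_int y * t\<bar> \<le> \<bar>real_of_int y\<bar> * (3883/10000)"
    unfolding abs_mult using t by (intro mult_left_mono) auto
  ultimately show "- (3883/10000 * \<bar>real_of_int y\<bar> + 1508/10000 * \<bar>real_of_int z\<bar>) \<le> x"
    and "x \<le> C + 3883/10000 * \<bar>real_of_int y\<bar> + 1508/10000 * \<bar>real_of_int z\<bar>"
    using r g(1) unfolding evr_def cub.sel by linarith+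
  have "?r * ?q \<le> C * C\<^sup>2" using g r C evc_nonneg[of t "Cub x y z"] by (intro mult_mono) auto
  then show "real_of_int k ^ 2 \<le> C ^ 3" unfolding rq by (simp add: power2_eq_square power3_eq_cube)
  show "- evr_upper (- x) (- y) (- z) \<le> 10000 * C"
    using evr_upper(2)[OF t(2,3), of x y z] g(1) by linarith
  have "10000 * (?r * ?q) \<le> 10000 * (?r * C\<^sup>2)" using g(2) r by simp
  also have "\<dots> = C\<^sup>2 * (10000 * ?r)" by simp
  also have "\<dots> \<le> C\<^sup>2 * evr_upper x y z"
    using evr_upper(1)[OF t(2,3), of x y z] by (intro mult_left_mono) auto
  finally show "10000 * cnorm (Cub x y z) \<le> C\<^sup>2 * evr_upper x y z"
    using evr_evc[OF t(1), of "Cub x y z"] by simp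
qed

lemma squares_upto:
  "(\<lambda>k. k * k) ` {1..24::int} = {1, 4, 9, 16, 25, 36, 49, 64, 81, 100, 121, 144, 169, 196, 225, 256, 289, 324, 361, 400, 441, 484, 529, 576}"
  "(\<lambda>k. k * k) ` {1..49::int} = {1, 4, 9, 16, 25, 36, 49, 64, 81, 100, 121, 144, 169, 196, 225, 256, 289, 324, 361, 400, 441, 484, 529, 576, 625, 676, 729, 784, 841, 900, 961, 1024, 1089, 1156, 1225, 1296, 1369, 1444, 1521, 1600, 1681, 1764, 1849, 1936, 2025, 2116, 2209, 2304, 2401}"
  unfolding set_upto[symmetric] by (simp_all add: upto_rec1 del: set_upto)

lemma quotient_in_table_1:
  fixes t :: real and x y z k :: int
  assumes t: "t ^ 3 + 5 * t = 2" "388/1000 \<le> t" "t \<le> 3883/10000"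
    and k: "k > 0" "cnorm (Cub x y z) = k\<^sup>2"
    and g: "evr t (Cub x y z) \<le> 848/100" "evc t (Cub x y z) \<le> (848/100)\<^sup>2"
  shows "Cub x y z \<in> set exceptional \<union> set (map fst class_table)"
proof -
  note R = quotient_region[OF t _ k g, simplified]
  have "\<bar>z\<bar> \<le> 3" using R(1) by linarith
  then have "\<bar>real_of_int z\<bar> \<le> 3" by linarith
  then have "\<bar>y\<bar> \<le> 4" using R(2) by linarith
  then have "\<bar>real_of_int y\<bar> \<le> 4" by linarith
  then have "-3 \<le> x" "x \<le> 11" using R(3,4) \<open>\<bar>real_of_int z\<bar> \<le> 3\<close> by linarith+
  \<comment> \<open>The value 8.48 is chosen with \<open>608 < 8.48^3 < 25^2\<close>.\<close>
  have "k < 25"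
  proof (rule ccontr)
    assume "\<not> k < 25"
    then have "(25::real)^2 \<le> real_of_int k ^ 2" by (intro power_mono) auto
    then show False using R(5) by (simp add: power3_eq_cube)
  qed
  have s: "search1 z y x"
    using \<open>\<bar>z\<bar> \<le> 3\<close> \<open>\<bar>y\<bar> \<le> 4\<close> \<open>-3 \<le> x\<close> \<open>x \<le> 11\<close> by (intro search1) auto
  have "k * k \<in> (\<lambda>k. k * k) ` {1..24}" using k \<open>k < 25\<close> by (intro imageI) auto
  then have N: "cnorm (Cub x y z) \<in> {1, 4, 9, 16, 25, 36, 49, 64, 81, 100, 121, 144, 169, 196, 225, 256, 289, 324, 361, 400, 441, 484, 529, 576}"
    unfolding k(2) power2_eq_square squares_upto .
  have a: "\<not> 84800 < - evr_upper (-x) (-y) (-z)" using R(6) by linarith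
  have b: "\<not> 719104 * evr_upper x y z < 100000000 * cnorm (Cub x y z)"
    using R(7) by (simp add: power2_eq_square)
  show ?thesis using s unfolding search1_def if_not_P[OF a] if_not_P[OF b] if_P[OF N] .
qed

lemma quotient_in_table_2:
  fixes t :: real and x y z k :: int
  assumes t: "t ^ 3 + 5 * t = 2" "388/1000 \<le> t" "t \<le> 3883/10000"
    and k: "k > 0" "cnorm (Cub x y z) = k\<^sup>2"
    and g: "evr t (Cub x y z) \<le> 1346/100" "evc t (Cub x y z) \<le> (1346/100)\<^sup>2"
    and par: "even y" "4 dvd x - z"
  shows "Cub x y z \<in> {Cub 9 (-2) 1} \<union> set (map fst class_table)"
proof -
  note R = quotient_region[OF t _ k g, simplified]
  have "\<bar>z\<bar> \<le> 5" using R(1) by linarith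
  then have "\<bar>real_of_int z\<bar> \<le> 5" by linarith
  then have "\<bar>y\<bar> \<le> 7" using R(2) by linarith
  then have "\<bar>real_of_int y\<bar> \<le> 7" by linarith
  then have "-4 \<le> x" "x \<le> 17" using R(3,4) \<open>\<bar>real_of_int z\<bar> \<le> 5\<close> by linarith+
  \<comment> \<open>Here \<open>C = 2 * 6.73\<close>, where \<open>2 * 6.73^3 > 608\<close> and
    \<open>C^3 < 50^2\<close>.\<close>
  have "k < 50"
  proof (rule ccontr)
    assume "\<not> k < 50"
    then have "(50::real)^2 \<le> real_of_int k ^ 2" by (intro power_mono) auto
    then show False using R(5) by (simp add: power3_eq_cube)
  qed
  obtain y' x' where xy: "y = 2 * y'" "x = z + 4 * x'"
    using par by (metis dvdE add_diff_cancel_left' diff_add_cancel add.commute)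
  have s: "search2 z y x"
    unfolding xy using \<open>\<bar>z\<bar> \<le> 5\<close> \<open>\<bar>y\<bar> \<le> 7\<close> \<open>-4 \<le> x\<close> \<open>x \<le> 17\<close> xy
    by (intro search2) auto
  have "k * k \<in> (\<lambda>k. k * k) ` {1..49}" using k \<open>k < 50\<close> by (intro imageI) auto
  then have N: "cnorm (Cub x y z) \<in> {1, 4, 9, 16, 25, 36, 49, 64, 81, 100, 121, 144, 169, 196, 225, 256, 289, 324, 361, 400, 441, 484, 529, 576, 625, 676, 729, 784, 841, 900, 961, 1024, 1089, 1156, 1225, 1296, 1369, 1444, 1521, 1600, 1681, 1764, 1849, 1936, 2025, 2116, 2209, 2304, 2401}"
    unfolding k(2) power2_eq_square squares_upto .
  have a: "\<not> 134600 < - evr_upper (-x) (-y) (-z)" using R(6) by linarith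
  have b: "\<not> 1811716 * evr_upper x y z < 100000000 * cnorm (Cub x y z)"
    using R(7) by (simp add: power2_eq_square)
  show ?thesis using s unfolding search2_def if_not_P[OF a] if_not_P[OF b] if_P[OF N] .
qed

lemma numeral_cub: "numeral k = Cub (numeral k) 0 0"
  by (metis of_int_cub of_int_numeral)

lemma class_table_class:
  assumes "g \<in> set (map fst class_table)"
  obtains \<kappa> \<eta> where "of_int 4 * g * \<kappa> = \<eta>\<^sup>2" "\<eta> \<noteq> 0"
    "\<kappa> \<in> {1, Cub 1 (-1) 0, Cub 0 1 1, Cub 4 1 1}"
proof -
  have "list_all (\<lambda>(g, \<kappa>, \<eta>). \<eta> \<noteq> 0 \<and> \<kappa> \<in> {1, Cub 1 (-1) 0, Cub 0 1 1, Cub 4 1 1}) class_table"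
    unfolding class_table_def by (simp add: zero_cub_def one_cub_def)
  then show ?thesis
    using assms class_table that unfolding list_all_iff
    by (fastforce simp: of_int_cub power2_eq_square)
qed

text \<open>The cubic has the root 3 modulo 5 and the root -3 modulo 11. In each case
  \<open>h\<close> is \<open>g (\<theta> - r) / p\<close>.\<close>

lemma exceptional_contradiction:
  assumes "g \<in> set exceptional" and c: "c = 1 \<or> c = 2" and cop: "coprime m n"
    and eq: "of_int c * b\<^sup>2 = Cub m (- n) 0 * g"
  shows False
proof -
  have p: "prime (5::int)" "prime (11::int)" by simp_all
  have c': "\<not> 5 dvd c" "\<not> 11 dvd c" using c by auto
  note red = cub_reduced_mod_prime[of 5] cub_reduced_mod_prime[of 11]
  consider "g = Cub 1 2 (-1)" | "g = Cub 4 (-2) 1" | "g = Cub 9 (-2) 1" | "g = Cub 3 (-3) 1"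
    using assms(1) by (auto simp: exceptional_def)
  then show False
  proof cases
    case 1
    show ?thesis
      by (rule degree_two_prime_contradiction[OF p(1) c'(1) cop red(1) eq, where r = 3 and h = "Cub (-1) 0 1"])
        (use p in \<open>simp_all add: 1 cub_mult numeral_cub cnorm_def\<close>)
  next
    case 2
    show ?thesis
      by (rule degree_two_prime_contradiction[OF p(1) c'(1) cop red(1) eq, where r = 3 and h = "Cub (-2) 1 (-1)"])
        (use p in \<open>simp_all add: 2 cub_mult numeral_cub cnorm_def\<close>)
  next
    case 3
    show ?thesis
      by (rule degree_two_prime_contradiction[OF p(1) c'(1) cop red(1) eq, where r = 3 and h = "Cub (-5) 2 (-1)"])
        (use p in \<open>simp_all add: 3 cub_mult numeral_cub cnorm_def\<close>)
  next
    case 4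
    show ?thesis
      by (rule degree_two_prime_contradiction[OF p(2) c'(2) cop red(2) eq, where r = "-3" and h = "Cub 1 (-1) 0"])
        (use p in \<open>simp_all add: 4 cub_mult numeral_cub cnorm_def\<close>)
  qed
qed

text \<open>Compare coefficients: that of \<open>\<theta>^2\<close> modulo 2 shows \<open>y\<close>
  even, and then that of \<theta> modulo 4 relates \<open>x\<close> and \<open>z\<close>.\<close>

lemma quotient_parity:
  assumes "even m" "odd n" and eq: "of_int 2 * (Cub u v w)\<^sup>2 = Cub m (- n) 0 * Cub x y z"
  shows "even y" "4 dvd x - z"
proof -
  have e: "2 * (v * v + 2 * u * w - 5 * w * w) = m * z - n * y"
    "4 * (u * v - 5 * v * w + w * w) = m * y - n * x + 5 * n * z"
    using eq by (simp_all add: of_int_cub Cub_square cub_mult algebra_simps)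
  then have "even (m * z - n * y)" by (metis dvd_triv_left)
  then show "even y" using assms by simp
  then have "4 dvd m * y" using \<open>even m\<close> mult_dvd_mono[of 2 m 2 y] by simp
  moreover have "n * (x - 5 * z) = m * y - 4 * (u * v - 5 * v * w + w * w)" using e(2) by (simp add: algebra_simps)
  ultimately have "4 dvd n * (x - 5 * z)" by (metis dvd_diff dvd_triv_left)
  moreover have "coprime 4 n" using \<open>odd n\<close>
    by (metis coprime_left_2_iff_odd coprime_mult_left_iff numeral_Bit0_eq_double one_add_one mult_2 numeral_times_numeral num_double semiring_norm(13))
  ultimately have "4 dvd x - 5 * z" by (simp add: coprime_dvd_mult_right_iff)
  then have "4 dvd (x - 5 * z) + 4 * z" by (intro dvd_add) auto
  then show "4 dvd x - z" by simp
qed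

text \<open>The quotient \<open>g\<close> from Minkowski's theorem lies in the table, so
  \<open>c \<alpha>\<close> has the class of one of four \<kappa>. Since
  \<open>m - 2 n = c \<delta>^2\<close>, the dyadic obstructions leave only
  \<open>\<kappa> = 1\<close>.\<close>

lemma two_class_trivial:
  fixes m n s c \<delta> :: int
  assumes cop: "coprime m n" and c: "c = 1 \<or> c = 2" and s: "c * s\<^sup>2 = cnorm (Cub m (- n) 0)"
    and \<delta>: "m - 2 * n = c * \<delta>\<^sup>2"
  shows "\<exists>b l. l \<noteq> 0 \<and> b\<^sup>2 = of_int (l\<^sup>2 * c) * Cub m (- n) 0"
proof -
  define \<alpha> where "\<alpha> = Cub m (- n) 0"
  have "\<alpha> \<noteq> 0" using cop by (auto simp: \<alpha>_def zero_cub_def)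
  then have s0: "s \<noteq> 0" using s unfolding \<alpha>_def[symmetric] by auto
  have c0: "c > 0" using c by auto
  obtain t :: real where t: "t ^ 3 + 5 * t = 2" "388/1000 \<le> t" "t \<le> 3883/10000"
    using real_root_bounds by blast
  have "\<exists>b g. b \<noteq> 0 \<and> of_int c * b\<^sup>2 = \<alpha> * g \<and> g \<in> set exceptional \<union> set (map fst class_table)"
    using c
  proof
    assume c1: "c = 1"
    obtain b g where bg: "b \<noteq> 0" "of_int c * b\<^sup>2 = \<alpha> * g" "evr t g \<le> 848/100" "evc t g \<le> (848/100)\<^sup>2"
      using small_quotient[OF t(1) cop c0 s0 s, of "848/100"] unfolding \<alpha>_def c1
      by (auto simp: power3_eq_cube)
    obtain k where "k > 0" "cnorm g = k\<^sup>2"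
      using cnorm_quotient_square[OF c0 s0 s] bg unfolding \<alpha>_def by blast
    then have "g \<in> set exceptional \<union> set (map fst class_table)"
      using quotient_in_table_1[OF t] bg by (cases g) blast
    then show ?thesis using bg by blast
  next
    assume c2: "c = 2"
    obtain b g where bg: "b \<noteq> 0" "of_int c * b\<^sup>2 = \<alpha> * g" "evr t g \<le> 1346/100" "evc t g \<le> (1346/100)\<^sup>2"
      using small_quotient[OF t(1) cop c0 s0 s, of "673/100"] unfolding \<alpha>_def c2
      by (auto simp: power3_eq_cube)
    obtain k where k: "k > 0" "cnorm g = k\<^sup>2"
      using cnorm_quotient_square[OF c0 s0 s] bg unfolding \<alpha>_def by blast
    obtain x y z where g: "g = Cub x y z" by (cases g)
    obtain u v w where b: "b = Cub u v w" by (cases b)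
    have "m = 2 * (\<delta>\<^sup>2 + n)" using \<delta> c2 by simp
    then have "even m" by simp
    moreover have "odd n" using cop \<open>even m\<close> by auto
    ultimately have "even y" "4 dvd x - z"
      using quotient_parity[of m n u v w x y z] bg(2) unfolding \<alpha>_def g b c2 by auto
    then have "g \<in> {Cub 9 (-2) 1} \<union> set (map fst class_table)"
      using quotient_in_table_2[OF t] bg k unfolding g by blast
    then have "g \<in> set exceptional \<union> set (map fst class_table)" by (auto simp: exceptional_def)
    then show ?thesis using bg by blast
  qed
  then obtain b g where b0: "b \<noteq> 0" and eq: "of_int c * b\<^sup>2 = \<alpha> * g"
    and g: "g \<in> set exceptional \<union> set (map fst class_table)" by blast
  have "g \<in> set (map fst class_table)"
    using exceptional_contradiction[OF _ c cop] eq g unfolding \<alpha>_def by blast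
  then obtain \<kappa> \<eta> where \<kappa>: "of_int 4 * g * \<kappa> = \<eta>\<^sup>2" "\<eta> \<noteq> 0" "\<kappa> \<in> {1, Cub 1 (-1) 0, Cub 0 1 1, Cub 4 1 1}"
    by (rule class_table_class)
  \<comment> \<open>Multiplying by \<open>cadj \<eta>\<close> turns the square
    \<open>4 g \<kappa> = \<eta>^2\<close> into the rational square \<open>l^2\<close> without
    division.\<close>
  define l B where "l = cnorm \<eta>" and "B = of_int (2 * c) * b * cadj \<eta>"
  have l0: "l \<noteq> 0" using \<kappa> by (simp add: l_def)
  have lB: "\<kappa> * B\<^sup>2 = of_int (l\<^sup>2 * c) * \<alpha>"
  proof -
    have "\<kappa> * B\<^sup>2 = of_int c * (of_int c * b\<^sup>2) * (of_int 4 * \<kappa> * (cadj \<eta>)\<^sup>2)"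
      by (simp add: B_def power2_eq_square algebra_simps)
    also have "\<dots> = of_int c * \<alpha> * ((of_int 4 * g * \<kappa>) * (cadj \<eta>)\<^sup>2)"
      unfolding eq by (simp add: algebra_simps)
    also have "\<dots> = of_int c * \<alpha> * (\<eta> * cadj \<eta>)\<^sup>2" unfolding \<kappa>(1) by (simp add: power_mult_distrib)
    also have "\<dots> = of_int (l\<^sup>2 * c) * \<alpha>" unfolding mult_cadj l_def by (simp add: algebra_simps)
    finally show ?thesis .
  qed
  then have lB': "\<kappa> * B\<^sup>2 = Cub (l\<^sup>2 * c * m) (- (l\<^sup>2 * c * n)) 0"
    by (simp only: of_int_cub \<alpha>_def) (simp add: cub_mult)
  have "\<alpha> * of_int (l\<^sup>2 * c) \<noteq> 0"
  proof -
    have "cnorm (\<alpha> * of_int (l\<^sup>2 * c)) \<noteq> 0"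
      unfolding cnorm_mult cnorm_of_int using \<open>\<alpha> \<noteq> 0\<close> l0 c0 by simp
    then show ?thesis by auto
  qed
  then have B0: "B \<noteq> 0" using lB by (auto simp: mult.commute)
  have "cf2 (\<kappa> * B\<^sup>2) = 0" "cf0 (\<kappa> * B\<^sup>2) + 2 * cf1 (\<kappa> * B\<^sup>2) = (l * c * \<delta>)\<^sup>2"
  proof -
    have "cf0 (\<kappa> * B\<^sup>2) + 2 * cf1 (\<kappa> * B\<^sup>2) = l\<^sup>2 * c * (m - 2 * n)"
      unfolding lB' by (simp add: algebra_simps)
    also have "\<dots> = (l * c * \<delta>)\<^sup>2" unfolding \<delta> by (simp add: power2_eq_square algebra_simps)
    finally show "cf0 (\<kappa> * B\<^sup>2) + 2 * cf1 (\<kappa> * B\<^sup>2) = (l * c * \<delta>)\<^sup>2" .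
  qed (simp add: lB')
  then have "\<kappa> = 1" using \<kappa>(3) B0 square_class_excluded_1 square_class_excluded_2 square_class_excluded_3 by blast
  then show ?thesis using lB l0 unfolding \<alpha>_def by auto
qed

text \<open>The vanishing $\theta^2$-coefficient of $b^2$ is a conic with the parametrisation $b_1/b_2=4Y/X-1$; in these
  coordinates the remaining condition is the original curve, and $X/Y\mapsto m/n$ is multiplication by 2.\<close>

lemma halving:
  fixes m n c \<delta> l :: int
  assumes cop: "coprime m n" and n: "n \<noteq> 0" and c: "c > 0" and \<delta>: "m - 2 * n = c * \<delta>\<^sup>2" and l: "l \<noteq> 0"
    and b: "b\<^sup>2 = of_int (l\<^sup>2 * c) * Cub m (- n) 0"
  shows "\<exists>X Y g W. coprime X Y \<and> (X - 2 * Y) * (X^3 + 5 * X * Y\<^sup>2 - 2 * Y^3) = W\<^sup>2 \<and> g \<noteq> 0 \<and>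
    2 * Y * (4 * Y^3 - 4 * X * Y\<^sup>2 - X\<^sup>2 * Y + 2 * X^3) = g * m \<and>
    X * (8 * Y^3 - 6 * X * Y\<^sup>2 + 4 * X\<^sup>2 * Y - X^3) = g * n"
proof -
  define L where "L = l\<^sup>2 * c"
  have L0: "L \<noteq> 0" using l c by (simp add: L_def)
  obtain b0 b1 b2 where bb: "b = Cub b0 b1 b2" by (cases b)
  have "Cub (b0*b0 + 4*b1*b2) (2*b0*b1 - 10*b1*b2 + 2*b2*b2) (b1*b1 + 2*b0*b2 - 5*b2*b2) = Cub (L * m) (- (L * n)) 0"
    using b unfolding bb Cub_square L_def of_int_cub cub_mult by simp
  then have e: "b0*b0 + 4*b1*b2 = L * m" "2*b0*b1 - 10*b1*b2 + 2*b2*b2 = - (L * n)" "b1*b1 + 2*b0*b2 - 5*b2*b2 = 0"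
    by simp_all
  have b20: "b2 \<noteq> 0"
  proof
    assume "b2 = 0"
    then have "b1 = 0" using e(3) by simp
    then show False using e(2) \<open>b2 = 0\<close> L0 n by simp
  qed
  \<comment> \<open>An integral representative of the parameter. The identities below eliminate
    \<open>b0\<close> through the conic \<open>2 b0 b2 = 5 b2^2 - b1^2\<close>.\<close>
  define X0 Y0 where "X0 = 4 * b2" and "Y0 = b1 + b2"
  have A0: "2 * Y0 * (4 * Y0^3 - 4 * X0 * Y0\<^sup>2 - X0\<^sup>2 * Y0 + 2 * X0^3) = 32 * b2\<^sup>2 * (L * m)"
    unfolding e(1)[symmetric] X0_def Y0_def using e(3) by algebra
  have B0: "X0 * (8 * Y0^3 - 6 * X0 * Y0\<^sup>2 + 4 * X0\<^sup>2 * Y0 - X0^3) = 32 * b2\<^sup>2 * (L * n)"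
  proof -
    have "X0 * (8 * Y0^3 - 6 * X0 * Y0\<^sup>2 + 4 * X0\<^sup>2 * Y0 - X0^3) = - (32 * b2\<^sup>2 * (2*b0*b1 - 10*b1*b2 + 2*b2*b2))"
      unfolding X0_def Y0_def using e(3) by algebra
    then show ?thesis unfolding e(2) by simp
  qed
  have "L * m - 2 * (L * n) = (l * c * \<delta>)\<^sup>2"
  proof -
    have "L * m - 2 * (L * n) = L * (m - 2 * n)" by (simp add: algebra_simps)
    also have "\<dots> = (l * c * \<delta>)\<^sup>2" unfolding \<delta> L_def by (simp add: power2_eq_square algebra_simps)
    finally show ?thesis .
  qed
  then have d: "(b0*b0 + 4*b1*b2) + 2 * (2*b0*b1 - 10*b1*b2 + 2*b2*b2) = (l * c * \<delta>)\<^sup>2" using e by simp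
  have C0: "(X0 - 2 * Y0) * (X0^3 + 5 * X0 * Y0\<^sup>2 - 2 * Y0^3) = (4 * b2 * (l * c * \<delta>))\<^sup>2"
    unfolding power_mult_distrib[of "4 * b2"] d[symmetric] X0_def Y0_def using e(3) by algebra
  define h where "h = gcd X0 Y0"
  have h0: "h \<noteq> 0" using b20 by (simp add: h_def X0_def)
  obtain X Y where XY: "X0 = h * X" "Y0 = h * Y" "coprime X Y"
    using gcd_coprime_exists[of X0 Y0] h0 unfolding h_def by (metis mult.commute)
  have A: "h^4 * (2 * Y * (4 * Y^3 - 4 * X * Y\<^sup>2 - X\<^sup>2 * Y + 2 * X^3)) = 32 * b2\<^sup>2 * L * m"
    using A0 unfolding XY by algebra
  have B: "h^4 * (X * (8 * Y^3 - 6 * X * Y\<^sup>2 + 4 * X\<^sup>2 * Y - X^3)) = 32 * b2\<^sup>2 * L * n"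
    using B0 unfolding XY by algebra
  have C: "(h\<^sup>2)\<^sup>2 * ((X - 2 * Y) * (X^3 + 5 * X * Y\<^sup>2 - 2 * Y^3)) = (4 * b2 * (l * c * \<delta>))\<^sup>2"
    using C0 unfolding XY by algebra
  have "h\<^sup>2 dvd 4 * b2 * (l * c * \<delta>)"
    using C by (metis dvd_triv_left pow_divides_pow_iff zero_less_numeral)
  then obtain W where "4 * b2 * (l * c * \<delta>) = h\<^sup>2 * W" by (elim dvdE)
  then have "(h\<^sup>2)\<^sup>2 * ((X - 2 * Y) * (X^3 + 5 * X * Y\<^sup>2 - 2 * Y^3)) = (h\<^sup>2)\<^sup>2 * W\<^sup>2"
    using C by (simp add: power_mult_distrib)
  then have W: "(X - 2 * Y) * (X^3 + 5 * X * Y\<^sup>2 - 2 * Y^3) = W\<^sup>2" using h0 by simp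
  define P Q where "P = 2 * Y * (4 * Y^3 - 4 * X * Y\<^sup>2 - X\<^sup>2 * Y + 2 * X^3)"
    and "Q = X * (8 * Y^3 - 6 * X * Y\<^sup>2 + 4 * X\<^sup>2 * Y - X^3)"
  \<comment> \<open>\<open>P / Q\<close> equals \<open>m / n\<close> in lowest terms, so
    \<open>P\<close> and \<open>Q\<close> share a common multiplier \<open>g\<close>.\<close>
  have "h^4 * (P * n) = h^4 * (Q * m)"
    using A B unfolding P_def[symmetric] Q_def[symmetric] by (metis mult.assoc mult.commute)
  then have PQ: "P * n = Q * m" using h0 by simp
  then have "n dvd Q * m" by (metis dvd_triv_right)
  then have "n dvd Q" using cop by (simp add: coprime_commute coprime_dvd_mult_left_iff)
  then obtain g where g: "Q = n * g" by (elim dvdE)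
  then have "P = m * g" using PQ n by simp
  moreover have "g \<noteq> 0"
  proof
    assume "g = 0"
    then have "32 * b2\<^sup>2 * L * n = 0" using B g unfolding Q_def[symmetric] by simp
    then show False using b20 L0 n by simp
  qed
  ultimately show ?thesis using XY(3) W g unfolding P_def Q_def by (metis mult.commute)
qed

section \<open>Descent on the curve\<close>

lemma square_mod_image: "p > 0 \<Longrightarrow> (d::int)\<^sup>2 mod p \<in> (\<lambda>k. k * k mod p) ` {0..p - 1}"
  by (intro image_eqI[of _ _ "d mod p"]) (auto simp: power2_eq_square mod_mult_eq)

lemma square_residues:
  fixes d :: int
  shows "d\<^sup>2 mod 7 \<in> {0, 1, 2, 4}"
    "d\<^sup>2 mod 9 \<in> {0, 1, 4, 7}"
    "d\<^sup>2 mod 11 \<in> {0, 1, 3, 4, 5, 9}"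
    "d\<^sup>2 mod 13 \<in> {0, 1, 3, 4, 9, 10, 12}"
    "d\<^sup>2 mod 17 \<in> {0, 1, 2, 4, 8, 9, 13, 15, 16}"
    "d\<^sup>2 mod 19 \<in> {0, 1, 4, 5, 6, 7, 9, 11, 16, 17}"
proof -
  show "d\<^sup>2 mod 7 \<in> {0, 1, 2, 4}"
    using square_mod_image[of 7 d] unfolding set_upto[symmetric] by (simp add: upto_rec1 del: set_upto) blast
  show "d\<^sup>2 mod 9 \<in> {0, 1, 4, 7}"
    using square_mod_image[of 9 d] unfolding set_upto[symmetric] by (simp add: upto_rec1 del: set_upto) blast
  show "d\<^sup>2 mod 11 \<in> {0, 1, 3, 4, 5, 9}"
    using square_mod_image[of 11 d] unfolding set_upto[symmetric] by (simp add: upto_rec1 del: set_upto) blast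
  show "d\<^sup>2 mod 13 \<in> {0, 1, 3, 4, 9, 10, 12}"
    using square_mod_image[of 13 d] unfolding set_upto[symmetric] by (simp add: upto_rec1 del: set_upto) blast
  show "d\<^sup>2 mod 17 \<in> {0, 1, 2, 4, 8, 9, 13, 15, 16}"
    using square_mod_image[of 17 d] unfolding set_upto[symmetric] by (simp add: upto_rec1 del: set_upto) blast
  show "d\<^sup>2 mod 19 \<in> {0, 1, 4, 5, 6, 7, 9, 11, 16, 17}"
    using square_mod_image[of 19 d] unfolding set_upto[symmetric] by (simp add: upto_rec1 del: set_upto) blast
qed

definition curve :: "int \<Rightarrow> int \<Rightarrow> int" where
  "curve m n = (m - 2 * n) * (m^3 + 5 * m * n\<^sup>2 - 2 * n^3)"

text \<open>A sieve for nonsquares; its moduli suffice for every value met in the small search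
  below.\<close>

definition nonresidue :: "int \<Rightarrow> bool" where
  "nonresidue v = (if v < 0 then True
     else if v mod 7 \<notin> {0, 1, 2, 4} then True
     else if v mod 9 \<notin> {0, 1, 4, 7} then True
     else if v mod 11 \<notin> {0, 1, 3, 4, 5, 9} then True
     else if v mod 13 \<notin> {0, 1, 3, 4, 9, 10, 12} then True
     else if v mod 17 \<notin> {0, 1, 2, 4, 8, 9, 13, 15, 16} then True
     else v mod 19 \<notin> {0, 1, 4, 5, 6, 7, 9, 11, 16, 17})"

lemma nonresidue:
  assumes "nonresidue (d\<^sup>2)"
  shows False
proof -
  have "\<not> d\<^sup>2 < 0" by simp
  then show False
    using assms square_residues[of d] unfolding nonresidue_def by (simp only: if_False if_True not_True_eq_False)
qed

text \<open>The base of the descent. The bound 15 comes from the height constant, as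
  \<open>3424 < 16^3\<close>.\<close>

lemma curve_points_small:
  assumes "\<bar>m\<bar> \<le> 15" "\<bar>n\<bar> \<le> 15" "curve m n = W\<^sup>2"
  shows "n = 0 \<or> m = 0 \<or> m = 2 * n"
proof -
  have u: "[1..15::int] = [1, 2, 3, 4, 5, 6, 7, 8, 9, 10, 11, 12, 13, 14, 15]"
    "[-15..15::int] = [-15, -14, -13, -12, -11, -10, -9, -8, -7, -6, -5, -4, -3, -2, -1, 0, 1, 2, 3, 4, 5, 6, 7, 8, 9, 10, 11, 12, 13, 14, 15]"
    by (simp_all add: upto_rec1)
  have "list_all (\<lambda>n. list_all (\<lambda>m. if m = 0 then True else if m = 2 * n then True
      else nonresidue (curve m n)) [-15..15]) [1..15]"
    unfolding u list.pred_inject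
    by (intro conjI TrueI; simp add: curve_def; simp add: nonresidue_def)
  then have search: "if m = 0 then True else if m = 2 * n then True else nonresidue (curve m n)"
    if "m \<in> {-15..15}" "n \<in> {1..15}" for m n
    using that unfolding list_all_iff set_upto by blast
  have pos: "m = 0 \<or> m = 2 * n" if "\<bar>m\<bar> \<le> 15" "1 \<le> n" "n \<le> 15" "curve m n = W\<^sup>2" for m n
  proof -
    have "if m = 0 then True else if m = 2 * n then True else nonresidue (curve m n)"
      using that by (intro search) auto
    then show ?thesis using nonresidue that(4) by (metis (full_types))
  qed
  show ?thesis
  proof (cases "n > 0")
    case True
    then show ?thesis using pos[of m n] assms by auto
  next
    case False
    \<comment> \<open>The form has even degree, so a common sign change is harmless.\<close>
    have "curve (- m) (- n) = W\<^sup>2"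
      using assms(3) by (simp add: curve_def power3_eq_cube power2_eq_square algebra_simps)
    then show ?thesis using False pos[of "- m" "- n"] assms(1,2) by auto
  qed
qed

text \<open>The cofactors are those of the resultant of the two quartic forms.\<close>

lemma doubling_height:
  fixes X Y g m n :: int
  assumes cop: "coprime X Y" and g0: "g \<noteq> 0"
    and A: "2 * Y * (4 * Y^3 - 4 * X * Y\<^sup>2 - X\<^sup>2 * Y + 2 * X^3) = g * m"
    and B: "X * (8 * Y^3 - 6 * X * Y\<^sup>2 + 4 * X\<^sup>2 * Y - X^3) = g * n"
  shows "max \<bar>X\<bar> \<bar>Y\<bar> ^ 4 \<le> 3424 * max \<bar>m\<bar> \<bar>n\<bar>"
proof -
  define H M where "H = max \<bar>X\<bar> \<bar>Y\<bar>" and "M = max \<bar>m\<bar> \<bar>n\<bar>"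
  define P1 Q1 P2 Q2 where "P1 = 38*Y^3 - 28*X*Y\<^sup>2 + 23*X\<^sup>2*Y - 6*X^3" and "Q1 = 66*Y^3 + 8*X*Y\<^sup>2 - 24*X\<^sup>2*Y"
    and "P2 = 48*X*Y\<^sup>2 - 24*X\<^sup>2*Y + 23*X^3" and "Q2 = 36*X*Y\<^sup>2 - 48*Y^3 + 16*X\<^sup>2*Y - 19*X^3"
  have y7: "304 * Y^7 = g * (P1 * m + Q1 * n)"
  proof -
    have "304 * Y^7 = P1 * (2 * Y * (4 * Y^3 - 4 * X * Y\<^sup>2 - X\<^sup>2 * Y + 2 * X^3)) + Q1 * (X * (8 * Y^3 - 6 * X * Y\<^sup>2 + 4 * X\<^sup>2 * Y - X^3))"
      unfolding P1_def Q1_def by algebra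
    then show ?thesis unfolding A B by (simp add: algebra_simps)
  qed
  have x7: "19 * X^7 = g * (P2 * m + Q2 * n)"
  proof -
    have "19 * X^7 = P2 * (2 * Y * (4 * Y^3 - 4 * X * Y\<^sup>2 - X\<^sup>2 * Y + 2 * X^3)) + Q2 * (X * (8 * Y^3 - 6 * X * Y\<^sup>2 + 4 * X\<^sup>2 * Y - X^3))"
      unfolding P2_def Q2_def by algebra
    then show ?thesis unfolding A B by (simp add: algebra_simps)
  qed
  \<comment> \<open>\<open>g\<close> divides 304 times both seventh powers, and \<open>X\<close>,
    \<open>Y\<close> are coprime.\<close>
  have "g dvd 304"
  proof -
    have "304 * X^7 = 16 * (19 * X^7)" by simp
    also have "\<dots> = g * (16 * (P2 * m + Q2 * n))" unfolding x7 by simp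
    finally have "g dvd 304 * X^7" by (rule dvdI)
    moreover have "g dvd 304 * Y^7" using y7 by (rule dvdI)
    ultimately have "g dvd gcd (304 * X^7) (304 * Y^7)" by simp
    also have "gcd (304 * X^7) (304 * Y^7) = 304"
      using cop by (simp add: gcd_mult_left coprime_imp_gcd_eq_1)
    finally show ?thesis .
  qed
  then have g: "\<bar>g\<bar> \<le> 304" using zdvd_imp_le[of "\<bar>g\<bar>" 304] by simp
  have H: "\<bar>X\<bar> \<le> H" "\<bar>Y\<bar> \<le> H" "0 \<le> H" by (auto simp: H_def)
  have M: "\<bar>m\<bar> \<le> M" "\<bar>n\<bar> \<le> M" "0 \<le> M" by (auto simp: M_def)
  have mono: "\<bar>X^3\<bar> \<le> H^3" "\<bar>X\<^sup>2*Y\<bar> \<le> H^3" "\<bar>X*Y\<^sup>2\<bar> \<le> H^3" "\<bar>Y^3\<bar> \<le> H^3"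
  proof -
    have "\<bar>u * v * w\<bar> \<le> H * H * H" if "\<bar>u\<bar> \<le> H" "\<bar>v\<bar> \<le> H" "\<bar>w\<bar> \<le> H" for u v w
      unfolding abs_mult using that H by (intro mult_mono) auto
    from this[of X X X] this[of X X Y] this[of X Y Y] this[of Y Y Y] show
      "\<bar>X^3\<bar> \<le> H^3" "\<bar>X\<^sup>2*Y\<bar> \<le> H^3" "\<bar>X*Y\<^sup>2\<bar> \<le> H^3" "\<bar>Y^3\<bar> \<le> H^3"
      using H by (simp_all add: power2_eq_square power3_eq_cube mult.assoc)
  qed
  \<comment> \<open>Sums of the absolute coefficients. With \<open>\<bar>g\<bar> \<le> 304\<close>
    the totals are 193 and 214, and \<open>3424 = 304 * 214 / 19\<close>.\<close>
  have c: "\<bar>P1\<bar> \<le> 95 * H^3" "\<bar>Q1\<bar> \<le> 98 * H^3" "\<bar>P2\<bar> \<le> 95 * H^3" "\<bar>Q2\<bar> \<le> 119 * H^3"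
    using mono unfolding P1_def Q1_def P2_def Q2_def by linarith+
  have bound: "\<bar>g * (P * m + Q * n)\<bar> \<le> 304 * ((p + q) * (H^3 * M))"
    if "\<bar>P\<bar> \<le> p * H^3" "\<bar>Q\<bar> \<le> q * H^3" "0 \<le> p" "0 \<le> q" for P Q p q
  proof -
    have "\<bar>P * m\<bar> \<le> p * H^3 * M" "\<bar>Q * n\<bar> \<le> q * H^3 * M"
      unfolding abs_mult using that H M by (auto intro!: mult_mono)
    then have "\<bar>P * m + Q * n\<bar> \<le> (p + q) * (H^3 * M)" by (simp add: algebra_simps)
    then show ?thesis unfolding abs_mult using g by (intro mult_mono) auto
  qed
  have "304 * \<bar>Y\<bar>^7 \<le> 304 * (193 * (H^3 * M))"
    using bound[OF c(1,2)] unfolding y7[symmetric] by (simp add: abs_mult power_abs)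
  moreover have "19 * \<bar>X\<bar>^7 \<le> 304 * (214 * (H^3 * M))"
    using bound[OF c(3,4)] unfolding x7[symmetric] by (simp add: abs_mult power_abs)
  moreover have "H^7 = \<bar>X\<bar>^7 \<or> H^7 = \<bar>Y\<bar>^7" unfolding H_def by (auto simp: max_def)
  moreover have "0 \<le> H^3 * M" using H M by simp
  ultimately have "H^7 \<le> 3424 * (H^3 * M)" by linarith
  then have "H^3 * H^4 \<le> H^3 * (3424 * M)" by (simp flip: power_add)
  moreover have "H > 0" using cop H by (auto simp: H_def max_def)
  ultimately have "H^4 \<le> 3424 * M" by (metis mult_le_cancel_left_pos zero_less_power)
  then show ?thesis unfolding H_def M_def .
qed

lemma coprime_square_factor:
  fixes a b w :: int
  assumes "coprime a b" "a * b = w\<^sup>2" and nz: "a \<noteq> 0" "b \<noteq> 0"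
  shows "\<exists>x. \<bar>a\<bar> = x\<^sup>2"
proof -
  have "nat \<bar>a\<bar> * nat \<bar>b\<bar> = (nat \<bar>w\<bar>)\<^sup>2"
  proof -
    have "\<bar>a\<bar> * \<bar>b\<bar> = \<bar>w\<bar>\<^sup>2" using assms(2) by (simp flip: abs_mult)
    then have "nat (\<bar>a\<bar> * \<bar>b\<bar>) = nat (\<bar>w\<bar>\<^sup>2)" by (rule arg_cong)
    then show ?thesis by (simp only: nat_mult_distrib nat_power_eq abs_ge_zero)
  qed
  moreover have "coprime (nat \<bar>a\<bar>) (nat \<bar>b\<bar>)" using assms(1) by simp
  ultimately have "is_nth_power 2 (nat \<bar>a\<bar>)"
    using is_nth_power_mult_coprime_natD(1)[of "nat \<bar>a\<bar>" "nat \<bar>b\<bar>" 2] nz by auto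
  then obtain x where "nat \<bar>a\<bar> = x\<^sup>2" by (auto elim: is_nth_powerE)
  then have "int (nat \<bar>a\<bar>) = int (x\<^sup>2)" by (rule arg_cong)
  then have "\<bar>a\<bar> = (int x)\<^sup>2" by simp
  then show ?thesis by blast
qed

text \<open>Dividing by the gcd leaves coprime factors of a square, which are squares up to a common
  sign. A divisor of 16 is 1 or 2 times a square, which gives \<open>c\<close>.\<close>

lemma square_product_split:
  fixes a b w :: int
  assumes "a \<noteq> 0" "b \<noteq> 0" "a * b = w\<^sup>2" "gcd a b dvd 16"
  shows "\<exists>\<sigma> c x y. (\<sigma> = 1 \<or> \<sigma> = -1) \<and> (c = 1 \<or> c = 2) \<and> \<sigma> * a = c * x\<^sup>2 \<and> \<sigma> * b = c * y\<^sup>2"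
proof -
  define g where "g = gcd a b"
  have g0: "g > 0" using assms by (simp add: g_def)
  obtain a' b' where ab: "a = g * a'" "b = g * b'" "coprime a' b'"
    using gcd_coprime_exists[of a b] g0 unfolding g_def by (metis less_irrefl mult.commute)
  have e: "g\<^sup>2 * (a' * b') = w\<^sup>2" using assms(3) unfolding ab by (simp add: power2_eq_square algebra_simps)
  then have "g dvd w" by (metis dvd_triv_left pow_divides_pow_iff zero_less_numeral)
  then obtain v where "w = g * v" by (elim dvdE)
  then have v: "a' * b' = v\<^sup>2" using e g0 by (simp add: power_mult_distrib)
  have nz: "a' \<noteq> 0" "b' \<noteq> 0" using assms(1,2) ab by auto
  obtain x where x: "\<bar>a'\<bar> = x\<^sup>2" using coprime_square_factor[OF ab(3) v nz] by blast
  have "coprime b' a'" "b' * a' = v\<^sup>2" using ab(3) v by (simp_all add: coprime_commute mult.commute)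
  then obtain y where y: "\<bar>b'\<bar> = y\<^sup>2" using coprime_square_factor nz by blast
  have "a' * b' \<ge> 0" unfolding v by simp
  then have sg: "0 < a' \<and> 0 < b' \<or> a' < 0 \<and> b' < 0" using nz by (auto simp: zero_le_mult_iff)
  define \<sigma> where "\<sigma> = sgn a'"
  have \<sigma>: "\<sigma> = 1 \<or> \<sigma> = -1" "\<sigma> * a' = x\<^sup>2" "\<sigma> * b' = y\<^sup>2"
    using sg unfolding x[symmetric] y[symmetric] \<sigma>_def by auto
  obtain c r where r: "c = 1 \<or> c = 2" "g = c * r\<^sup>2"
  proof -
    have "g \<le> 16" using assms(4) zdvd_imp_le[of g 16] by (simp add: g_def)
    then have "g \<in> {1..16}" using g0 by simp
    then have "g \<in> set [1..16]" by simp
    then have "g \<in> {1, 2, 4, 8, 16}"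
      using assms(4) unfolding g_def[symmetric] by (auto simp: upto_rec1 simp del: set_upto)
    then show ?thesis
      using that[of 1 1] that[of 2 1] that[of 1 2] that[of 2 2] that[of 1 4] by auto
  qed
  have "\<sigma> * a = c * (r * x)\<^sup>2" "\<sigma> * b = c * (r * y)\<^sup>2"
    using \<sigma>(2,3) r(2) ab by (simp_all add: power_mult_distrib algebra_simps)
  then show ?thesis using \<sigma>(1) r(1) by blast
qed

text \<open>Induction on the height. A nontrivial point would be the double of a nontrivial point
  \<open>X / Y\<close> with \<open>H^4 \<le> 3424 M\<close>; either \<open>H < M\<close>, or the
  given point lies in the searched box.\<close>

lemma curve_points:
  assumes "coprime m n" "curve m n = V\<^sup>2"
  shows "n = 0 \<or> m = 0 \<or> m = 2 * n"
  using assms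
proof (induction "nat (max \<bar>m\<bar> \<bar>n\<bar>)" arbitrary: m n V rule: less_induct)
  case less
  note cop = less.prems(1)
  show ?case
  proof (rule ccontr)
    assume neg: "\<not> ?thesis"
    define a where "a = m - 2 * n"
    define b where "b = m^3 + 5 * m * n\<^sup>2 - 2 * n^3"
    have b: "b = cnorm (Cub m (- n) 0)" by (simp add: b_def cnorm_def)
    have "Cub m (- n) 0 \<noteq> 0" using neg by (auto simp: zero_cub_def)
    then have b0: "b \<noteq> 0" unfolding b cnorm_eq_0_iff .
    have a0: "a \<noteq> 0" using neg by (simp add: a_def)
    have ab: "a * b = V\<^sup>2" using less.prems(2) by (simp add: a_def b_def curve_def)
    have "gcd a b dvd 16"
    proof -
      \<comment> \<open>16 is the value of \<open>u^3 + 5 u - 2\<close> at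
        \<open>u = 2\<close>.\<close>
      have "b - a * (m\<^sup>2 + 2 * m * n + 9 * n\<^sup>2) = 16 * n^3" unfolding a_def b_def by algebra
      then have "gcd a b dvd 16 * n^3" by (metis dvd_diff dvd_mult2 gcd_dvd1 gcd_dvd2)
      moreover have "coprime a n"
      proof -
        have "gcd (m - 2 * n) n = gcd m n" by (metis gcd_diff1 gcd.commute gcd_add_mult diff_add_cancel add.commute)
        then show ?thesis using cop by (simp add: a_def coprime_iff_gcd_eq_1)
      qed
      then have "coprime (gcd a b) (n^3)" by (meson coprime_power_right_iff coprime_divisors dvd_refl gcd_dvd1)
      ultimately show ?thesis by (simp add: coprime_dvd_mult_left_iff)
    qed
    from square_product_split[OF a0 b0 ab this] obtain \<sigma> c \<delta> s
      where \<sigma>: "\<sigma> = 1 \<or> \<sigma> = -1" and c: "c = 1 \<or> c = 2" and ds: "\<sigma> * a = c * \<delta>\<^sup>2" "\<sigma> * b = c * s\<^sup>2" by blast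
    \<comment> \<open>The common sign is absorbed into the coordinates.\<close>
    define m' n' where "m' = \<sigma> * m" and "n' = \<sigma> * n"
    have cop': "coprime m' n'" using cop \<sigma> by (auto simp: m'_def n'_def)
    have d': "m' - 2 * n' = c * \<delta>\<^sup>2" using ds(1) by (simp add: a_def m'_def n'_def algebra_simps)
    have s': "c * s\<^sup>2 = cnorm (Cub m' (- n') 0)"
      unfolding ds(2)[symmetric] b m'_def n'_def using \<sigma> by (auto simp: cnorm_def)
    have n': "n' \<noteq> 0" using neg \<sigma> by (auto simp: n'_def)
    have c0: "c > 0" using c by auto
    obtain B l where "l \<noteq> 0" "B\<^sup>2 = of_int (l\<^sup>2 * c) * Cub m' (- n') 0"
      using two_class_trivial[OF cop' c s' d'] by blast
    from halving[OF cop' n' c0 d' this] obtain X Y g W where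
      XY: "coprime X Y" "(X - 2 * Y) * (X^3 + 5 * X * Y\<^sup>2 - 2 * Y^3) = W\<^sup>2" "g \<noteq> 0"
        "2 * Y * (4 * Y^3 - 4 * X * Y\<^sup>2 - X\<^sup>2 * Y + 2 * X^3) = g * m'"
        "X * (8 * Y^3 - 6 * X * Y\<^sup>2 + 4 * X\<^sup>2 * Y - X^3) = g * n'" by blast
    define H M where "H = max \<bar>X\<bar> \<bar>Y\<bar>" and "M = max \<bar>m\<bar> \<bar>n\<bar>"
    have M': "max \<bar>m'\<bar> \<bar>n'\<bar> = M" using \<sigma> by (auto simp: m'_def n'_def M_def)
    have hM: "H^4 \<le> 3424 * M" using doubling_height[OF XY(1,3,4,5)] unfolding H_def M' .
    have curveXY: "curve X Y = W\<^sup>2" using XY(2) by (simp add: curve_def)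
    \<comment> \<open>Doubling sends infinity to 0, 0 to infinity and 2 to 2, so a trivial half
      would make the point itself trivial.\<close>
    have triv: "\<not> (Y = 0 \<or> X = 0 \<or> X = 2 * Y)"
    proof
      assume "Y = 0 \<or> X = 0 \<or> X = 2 * Y"
      then consider "Y = 0" | "X = 0" | "X = 2 * Y" by blast
      then show False
      proof cases
        case 1
        then show False using XY(3,4) neg \<sigma> by (auto simp: m'_def)
      next
        case 2
        then show False using XY(3,5) neg \<sigma> by (auto simp: n'_def)
      next
        case 3
        then have "g * m' = 16 * Y^4" "g * n' = 8 * Y^4"
          unfolding XY(4,5)[symmetric] by (simp_all add: power2_eq_square power3_eq_cube power4_eq_xxxx)
        then have "g * m' = g * (2 * n')" by simp
        then have "m' = 2 * n'" using XY(3) by simp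
        then show False using neg \<sigma> by (auto simp: m'_def n'_def)
      qed
    qed
    show False
    proof (cases "H < M")
      case True
      moreover have "0 \<le> H" by (simp add: H_def)
      ultimately have "nat H < nat M" by simp
      then show False using less.hyps[OF _ XY(1) curveXY] triv unfolding H_def M_def by blast
    next
      case False
      have "H < 16"
      proof (rule ccontr)
        assume "\<not> H < 16"
        then have "(16::int)^3 \<le> H^3" by (intro power_mono) auto
        then have "4096 * H \<le> H^3 * H" using \<open>\<not> H < 16\<close> by (intro mult_right_mono) auto
        moreover have "H^3 * H = H^4" by (simp add: power3_eq_cube power4_eq_xxxx)
        ultimately show False using hM False \<open>\<not> H < 16\<close> by linarith
      qed
      then have "\<bar>m\<bar> \<le> 15" "\<bar>n\<bar> \<le> 15" using False by (auto simp: M_def)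
      then show False using curve_points_small less.prems(2) neg by blast
    qed
  qed
qed

lemma int_square_of_rat_square:
  fixes w :: rat
  assumes "of_int k = w\<^sup>2"
  shows "\<exists>r. k = r\<^sup>2"
proof -
  obtain p q where pq: "quotient_of w = (p, q)" by (cases "quotient_of w")
  then have q: "q > 0" "coprime p q" and w: "w = of_int p / of_int q"
    using quotient_of_denom_pos quotient_of_coprime quotient_of_div by blast+
  have "of_int (k * q\<^sup>2) = (of_int (p\<^sup>2) :: rat)"
    using assms q(1) by (simp add: w power_divide field_simps)
  then have e: "k * q\<^sup>2 = p\<^sup>2" by (simp only: of_int_eq_iff)
  then have "q\<^sup>2 dvd p\<^sup>2" by (metis dvd_triv_right)
  then have "q dvd p" by simp
  then have "q = 1" using q by (metis coprime_common_divisor dvd_refl zdvd1_eq abs_of_pos)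
  then show ?thesis using e by auto
qed

lemma rational_curve_points:
  fixes u v :: rat
  assumes "v\<^sup>2 = (u - 2) * (u^3 + 5 * u - 2)"
  shows "u = 0 \<or> u = 2"
proof -
  obtain m n where mn: "quotient_of u = (m, n)" by (cases "quotient_of u")
  then have n: "n > 0" "coprime m n" and u: "u = of_int m / of_int n"
    using quotient_of_denom_pos quotient_of_coprime quotient_of_div by blast+
  have "of_int (curve m n) = (v * (of_int n)\<^sup>2)\<^sup>2"
  proof -
    have "(v * (of_int n)\<^sup>2)\<^sup>2 = (u - 2) * (u^3 + 5 * u - 2) * (of_int n)^4"
      unfolding power_mult_distrib assms by simp
    also have "\<dots> = of_int (curve m n)"
      unfolding u curve_def using n(1) by (simp add: field_simps power2_eq_square power3_eq_cube power4_eq_xxxx)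
    finally show ?thesis by simp
  qed
  then obtain V where "curve m n = V\<^sup>2" using int_square_of_rat_square by blast
  then have "m = 0 \<or> m = 2 * n" using curve_points n by fastforce
  then show ?thesis using n by (auto simp: u)
qed

section \<open>Quadratic factors\<close>

text \<open>Eliminating \<open>a\<close> leaves a relation between \<open>t\<close> and
  \<open>F\<close>. On the lines \<open>F = u t + 2\<close> it becomes quadratic in
  \<open>t\<close>, and its discriminant is the quartic of the curve, so \<open>u\<close> is 0 or
  2.\<close>

lemma remainder_equations_contradiction_1:
  fixes a p q :: rat
  assumes a: "a \<noteq> 0"
    and r1: "p^4 - 3 * p\<^sup>2 * q + q\<^sup>2 + 1 = a * p" and r0: "a * (q - 1) = p * q * (p\<^sup>2 - 2 * q)"
  shows False
proof -
  define t F where "t = q - 1" and "F = (q - 1)\<^sup>2 + p\<^sup>2"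
  have "p \<noteq> 0"
  proof
    assume "p = 0"
    then have "1 + q\<^sup>2 = 0" using r1 by simp
    then show False using zero_le_power2[of q] by linarith
  qed
  have t0: "t \<noteq> 0"
  proof
    assume "t = 0"
    then have q: "q = 1" by (simp add: t_def)
    then have "p * (p\<^sup>2 - 2) = 0" using r0 by simp
    then have p2: "p\<^sup>2 = 2" using \<open>p \<noteq> 0\<close> by simp
    have "a * p = p\<^sup>2 * p\<^sup>2 - 3 * p\<^sup>2 + 2" using r1 q by (simp add: power2_eq_square power4_eq_xxxx)
    then have "a * p = 0" unfolding p2 by simp
    then show False using a \<open>p \<noteq> 0\<close> by simp
  qed
  \<comment> \<open>Multiply \<open>r0\<close> by \<open>p\<close>, so that \<open>r1\<close> can
    replace \<open>a p\<close>.\<close>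
  have "(a * p) * (q - 1) = p\<^sup>2 * q * (p\<^sup>2 - 2 * q)" using r0 by algebra
  then have FE: "F * t\<^sup>2 + (F + 2) * t - F\<^sup>2 + 2 * F = 0"
    unfolding r1[symmetric] F_def t_def by algebra
  define u where "u = (F - 2) / t"
  have Fu: "F = u * t + 2" using t0 by (simp add: u_def)
  have "t * (u * t\<^sup>2 + (u - u\<^sup>2 + 2) * t + 4 - 2 * u) = 0" using FE unfolding Fu by algebra
  then have Z: "u * t\<^sup>2 + (u - u\<^sup>2 + 2) * t + 4 - 2 * u = 0" using t0 by simp
  \<comment> \<open>Complete the square in \<open>t\<close>.\<close>
  then have "(2 * u * t + (u - u\<^sup>2 + 2))\<^sup>2 = (u - 2) * (u^3 + 5 * u - 2)" by algebra
  then have "u = 0 \<or> u = 2" by (rule rational_curve_points)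
  then show False
  proof
    assume "u = 0"
    then have "t = -2" "F = 2" using Z Fu by simp_all
    moreover have "F = t\<^sup>2 + p\<^sup>2" by (simp add: F_def t_def)
    ultimately have "p\<^sup>2 = -2" by simp
    then show False using zero_le_power2[of p] by linarith
  next
    assume "u = 2"
    then show False using Z t0 by simp
  qed
qed

lemma two_not_rat_square: "(p :: rat)\<^sup>2 \<noteq> 2"
proof
  assume "p\<^sup>2 = 2"
  then have "of_int 2 = p\<^sup>2" by simp
  then obtain r :: int where "2 = r\<^sup>2" using int_square_of_rat_square by blast
  then show False using square_mod_4[of r] by auto
qed

text \<open>\<open>R1 x + R0\<close> is the remainder of \<open>x^4 + 1\<close>, and the equations
  say that its product with \<open>x + a\<close> is divisible by the quadratic. Either the quadratic
  divides \<open>x^4 + 1\<close>, or it splits off \<open>x + a\<close> and the other factor gives a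
  rational root of \<open>x^4 + 1\<close>.\<close>

lemma remainder_equations_contradiction_2:
  fixes a p q :: rat
  assumes R1: "R1 = p * (2 * q - p\<^sup>2)" and R0: "R0 = 1 - p\<^sup>2 * q + q\<^sup>2"
    and r: "R0 = (p - a) * R1" "a * R0 = q * R1"
  shows False
proof (cases "R1 = 0")
  case True
  then have "R0 = 0" using r by simp
  consider "p = 0" | "p\<^sup>2 = 2 * q" using True R1 by auto
  then show False
  proof cases
    case 1
    then have "1 + q\<^sup>2 = 0" using R0 \<open>R0 = 0\<close> by simp
    then show False using zero_le_power2[of q] by linarith
  next
    case 2
    then have "q\<^sup>2 = 1" using R0 \<open>R0 = 0\<close> by (simp add: power2_eq_square)
    then have "q = 1 \<or> q = -1" by (simp add: power2_eq_1_iff)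
    moreover have "q \<ge> 0" using 2 zero_le_power2[of p] by linarith
    ultimately show False using 2 two_not_rat_square[of p] by auto
  qed
next
  case False
  \<comment> \<open>The quadratic turns out to be \<open>(x + a) (x + b)\<close>; then
    \<open>b^4 + 1\<close> is the remainder evaluated at \<open>-b\<close>.\<close>
  define b where "b = p - a"
  have p: "p = a + b" by (simp add: b_def)
  have "(a * b - q) * R1 = 0" using r unfolding p by algebra
  then have q: "q = a * b" using False by simp
  have "b^4 + 1 = R0 - b * R1" unfolding R0 R1 p q by algebra
  also have "\<dots> = 0" using r(1) by (simp add: b_def)
  finally have "b^4 + 1 = 0" .
  moreover have "0 \<le> b^4" by simp
  ultimately show False by linarith
qed

lemma quadratic_dvd_remainder:
  fixes q p r0 r1 :: rat
  assumes "[:q, p, 1:] dvd f" "f = [:q, p, 1:] * g + [:r0, r1:]"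
  shows "r0 = 0" "r1 = 0"
proof -
  have "[:q, p, 1:] dvd [:r0, r1:]" using assms by (metis dvd_add_right_iff dvd_triv_left)
  then have "[:r0, r1:] = 0 \<or> degree [:q, p, 1:] \<le> degree [:r0, r1:]" using dvd_imp_degree_le by blast
  then have "[:r0, r1:] = 0" by (auto split: if_splits)
  then show "r0 = 0" "r1 = 0" by auto
qed

theorem theorem3p3:
  fixes a :: rat
  assumes "a \<noteq> 0"
  shows "\<not> has_quadratic_factor (monom 1 5 + monom a 2 + monom 1 1 + [:a:])
    \<and> \<not> has_quadratic_factor (monom 1 5 + monom a 4 + monom 1 1 + [:a:])"
proof (intro conjI notI)
  assume "has_quadratic_factor (monom 1 5 + monom a 2 + monom 1 1 + [:a:])"
  then obtain p q where dvd: "[:q, p, 1:] dvd monom 1 5 + monom a 2 + monom 1 1 + [:a:]"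
    unfolding has_quadratic_factor_def by blast
  \<comment> \<open>Explicit division with remainder.\<close>
  have "monom 1 5 + monom a 2 + monom 1 1 + [:a:] =
      [:q, p, 1:] * [:a - p^3 + 2 * p * q, p\<^sup>2 - q, - p, 1:]
      + [:a - q * (a - p^3 + 2 * p * q), 1 - p * (a - p^3 + 2 * p * q) - q * (p\<^sup>2 - q):]"
    by (simp add: monom_Suc numeral_eq_Suc monom_0 algebra_simps power2_eq_square power3_eq_cube)
  from quadratic_dvd_remainder[OF dvd this]
  have "a - q * (a - p^3 + 2 * p * q) = 0" "1 - p * (a - p^3 + 2 * p * q) - q * (p\<^sup>2 - q) = 0" .
  then have "p^4 - 3 * p\<^sup>2 * q + q\<^sup>2 + 1 = a * p" "a * (q - 1) = p * q * (p\<^sup>2 - 2 * q)"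
    by algebra+
  then show False by (rule remainder_equations_contradiction_1[OF assms])
next
  assume "has_quadratic_factor (monom 1 5 + monom a 4 + monom 1 1 + [:a:])"
  then obtain p q where dvd: "[:q, p, 1:] dvd monom 1 5 + monom a 4 + monom 1 1 + [:a:]"
    unfolding has_quadratic_factor_def by blast
  define R0 R1 where "R0 = 1 - p\<^sup>2 * q + q\<^sup>2" and "R1 = p * (2 * q - p\<^sup>2)"
  \<comment> \<open>Division with remainder again, with \<open>R1 x + R0\<close> the remainder of
    \<open>x^4 + 1\<close>.\<close>
  have "monom 1 5 + monom a 4 + monom 1 1 + [:a:] =
      [:q, p, 1:] * [:R1 + a * (p\<^sup>2 - q), p\<^sup>2 - q - a * p, a - p, 1:]
      + [:a * R0 - q * R1, R0 + a * R1 - p * R1:]"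
    by (simp add: R0_def R1_def monom_Suc numeral_eq_Suc monom_0 algebra_simps power2_eq_square power3_eq_cube)
  from quadratic_dvd_remainder[OF dvd this] have "R0 = (p - a) * R1" "a * R0 = q * R1"
    by (simp_all add: algebra_simps)
  then show False by (rule remainder_equations_contradiction_2[OF R1_def R0_def])
qed

end
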